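(* For any fixed partition $\mu=(\mu_1,\dots,\mu_k)$ with $k$ (positive) parts, $$\max\{\mathrm{ht}(\mu),\mathrm{wd}(\mu)\}\le \liminf_{n\rightarrow\infty}\,(\mathrm{avoid}_n^\mu)^{1/2n}$$ and $$\limsup_{n\rightarrow\infty}\,(\mathrm{avoid}_n^\mu)^{1/2n} \le \mathrm{ht}(\mu)+\mathrm{wd}(\mu),$$ where $\mathrm{ht}(\mu):=k-1$ and $\mathrm{wd}(\mu):=\mu_1-1$.
   Context: The shape of a permutation is the common shape (a partition) of the two standard Young tableaux associated to it by the Robinson-Schensted(-Knuth) correspondence (by row insertion). A permutation $\pi=(\pi_1,\dots,\pi_n)\in S_n$ avoids a permutation $\sigma=(\sigma_1,\dots,\sigma_m)\in S_m$ if there is no subsequence $(\pi_{i_1},\dots,\pi_{i_m})$, $i_1<\dots<i_m$, of $\pi$ such that for all $j,l$: $\pi_{i_j}>\pi_{i_l}$ iff $\sigma_j>\sigma_l$. For a partition $\mu$ of $m$, $\pi$ is $\mu$-avoiding if it avoids all permutations in $S_m$ of shape $\mu$. $\mathrm{avoid}_n^\mu$ denotes the number of $\mu$-avoiding permutations in $S_n$. The exponent $1/2n$ means $1/(2n)$. *)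

theory Defs
  imports "HOL-Library.Extended_Real" "HOL-Combinatorics.Multiset_Permutations"
begin

definition is_partition :: "nat list \<Rightarrow> bool" where
  "is_partition \<mu> \<longleftrightarrow> sorted_wrt (\<ge>) \<mu> \<and> (\<forall>x \<in> set \<mu>. x > 0)"

(* ht and wd are only used for nonempty partitions, where the subtraction does not truncate. *)

definition ht :: "nat list \<Rightarrow> nat" where
  "ht \<mu> = length \<mu> - 1"

definition wd :: "nat list \<Rightarrow> nat" where
  "wd \<mu> = hd \<mu> - 1"

(* The second component is the entry bumped out of the row, if there is one. *)

fun bump :: "'a::linorder \<Rightarrow> 'a list \<Rightarrow> 'a list \<times> 'a option" where
  "bump x [] = ([x], None)"
| "bump x (y # ys) =
     (if x < y then (x # ys, Some y)
      else (case bump x ys of (zs, b) \<Rightarrow> (y # zs, b)))"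

fun row_insert :: "'a::linorder \<Rightarrow> 'a list list \<Rightarrow> 'a list list" where
  "row_insert x [] = [[x]]"
| "row_insert x (r # rs) =
     (case bump x r of
        (r', None) \<Rightarrow> r' # rs
      | (r', Some y) \<Rightarrow> r' # row_insert y rs)"

definition insertion_tableau :: "'a::linorder list \<Rightarrow> 'a list list" where
  "insertion_tableau \<pi> = fold row_insert \<pi> []"

(* The recording tableau labels the cells of the insertion tableau in order of creation,
   so the two tableaux have the same shape and the insertion tableau suffices. *)

definition rs_shape :: "'a::linorder list \<Rightarrow> nat list" where
  "rs_shape \<pi> = map length (insertion_tableau \<pi>)"

(* Permutations in one-line notation: S_n is permutations_of_set {1..n}. *)

definition avoids :: "nat list \<Rightarrow> nat list \<Rightarrow> bool" where
  "avoids \<pi> \<sigma> \<longleftrightarrow>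
     \<not> (\<exists>i. strict_mono_on {..<length \<sigma>} i \<and> i ` {..<length \<sigma>} \<subseteq> {..<length \<pi>} \<and>
          (\<forall>j<length \<sigma>. \<forall>l<length \<sigma>. \<pi> ! i j > \<pi> ! i l \<longleftrightarrow> \<sigma> ! j > \<sigma> ! l))"

definition shape_avoiding :: "nat list \<Rightarrow> nat list \<Rightarrow> bool" where
  "shape_avoiding \<mu> \<pi> \<longleftrightarrow>
     (\<forall>\<sigma> \<in> permutations_of_set {1..sum_list \<mu>}. rs_shape \<sigma> = \<mu> \<longrightarrow> avoids \<pi> \<sigma>)"

definition avoid_count :: "nat list \<Rightarrow> nat \<Rightarrow> nat" where
  "avoid_count \<mu> n = card {\<pi> \<in> permutations_of_set {1..n}. shape_avoiding \<mu> \<pi>}"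

end

theory Submission
  imports Defs "HOL-Library.Sublist" "HOL-Real_Asymp.Real_Asymp"
begin

text \<open>
  Upper bound. By Greene's theorem, obtained here from invariance under Knuth relations, a
  permutation of shape \<open>\<lambda>\<close> contains \<open>a\<close> increasing subsequences covering \<open>\<lambda>\<^sub>1 + \<dots> + \<lambda>\<^sub>a\<close> entries
  and \<open>b\<close> decreasing ones covering as many entries as the first \<open>b\<close> columns of \<open>\<lambda>\<close> have cells.
  An increasing and a decreasing subsequence share at most one entry. So if \<open>(a, b)\<close> lies on the
  boundary path of \<open>\<lambda>\<close>, counting shows that these subsequences cover everything and that each
  increasing one meets each decreasing one exactly once. If \<open>\<lambda>\<close> contains the rectangle with
  \<open>ht \<mu> + 1\<close> rows and \<open>wd \<mu> + 1\<close> columns, the intersection points form a grid, and the subgrid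
  indexed by the cells of \<open>\<mu>\<close> is a pattern whose shape dominates \<open>\<mu>\<close> by rows and by columns and
  hence equals \<open>\<mu>\<close>. Otherwise \<open>(a, b)\<close> can be chosen with \<open>a \<le> ht \<mu>\<close> and \<open>b \<le> wd \<mu>\<close>. A permutation
  that splits into \<open>a\<close> increasing and \<open>b\<close> decreasing subsequences is determined by the colours of
  its positions and of its values, which leaves at most \<open>(ht \<mu> + wd \<mu>)\<^sup>2\<^sup>n\<close> permutations.

  Lower bound. A permutation of shape \<open>\<mu>\<close> has a decreasing subsequence of length \<open>ht \<mu> + 1\<close> and an
  increasing one of length \<open>wd \<mu> + 1\<close>, so the unions of \<open>ht \<mu>\<close> increasing subsequences and those
  of \<open>wd \<mu>\<close> decreasing ones avoid \<open>\<mu>\<close>. Unions of \<open>a\<close> increasing subsequences come from pairs of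
  words over \<open>a\<close> letters; arranging long blocks of fixed content along a diagonal band makes the
  pair of words recoverable, which gives \<open>a\<^sup>2\<^sup>n\<close> permutations up to a subexponential factor.
\<close>

section \<open>Knuth invariance of increasing covers\<close>

text \<open>Covers by decreasing subsequences of \<open>w\<close> are expressed as \<open>inc_cover\<close> of \<open>rev w\<close>.\<close>

definition inc_cover :: "nat \<Rightarrow> nat \<Rightarrow> 'a::linorder list \<Rightarrow> bool" where
  "inc_cover r N w \<longleftrightarrow> (\<exists>f :: 'a \<Rightarrow> nat. (\<forall>c<r. sorted (filter (\<lambda>x. f x = c) w)) \<and>
     N \<le> length (filter (\<lambda>x. f x < r) w))"

text \<open>The elementary Knuth relations in one direction, each moving \<open>c\<close> in front
  of \<open>a\<close> next to a letter \<open>b\<close> of intermediate value;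
  \<open>equivclp\<close> later supplies the equivalence. The strict inequalities suit words with
  distinct letters.\<close>

inductive knuth :: "'a::linorder list \<Rightarrow> 'a list \<Rightarrow> bool" where
  bac: "a < b \<Longrightarrow> b < c \<Longrightarrow> knuth (p @ [b, a, c] @ s) (p @ [b, c, a] @ s)"
| acb: "a < b \<Longrightarrow> b < c \<Longrightarrow> knuth (p @ [a, c, b] @ s) (p @ [c, a, b] @ s)"

lemma knuth_mset: "knuth w w' \<Longrightarrow> mset w = mset w'"
  by (induction rule: knuth.induct) auto

lemma knuth_append: "knuth w w' \<Longrightarrow> knuth (p @ w @ s) (p @ w' @ s)"
proof (induction rule: knuth.induct)
  case (bac a b c p' s')
  then show ?case using knuth.bac[of a b c "p @ p'" "s' @ s"] by simp
next
  case (acb a b c p' s')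
  then show ?case using knuth.acb[of a b c "p @ p'" "s' @ s"] by simp
qed

text \<open>Reversal exchanges the two relations and their direction. This carries invariance over
  to decreasing covers, which are increasing covers of the reversed word.\<close>

lemma knuth_rev: "knuth w w' \<Longrightarrow> knuth (rev w') (rev w)"
proof (induction rule: knuth.induct)
  case (bac a b c p s)
  then show ?case using knuth.acb[of a b c "rev s" "rev p"] by simp
next
  case (acb a b c p s)
  then show ?case using knuth.bac[of a b c "rev s" "rev p"] by simp
qed

text \<open>If \<open>a\<close> and \<open>c\<close> lie in the same class, their exchange breaks it. When \<open>b\<close> is uncovered it replaces
  the letter that is now out of order; when \<open>b\<close> lies in another class, the two classes swap their tails.\<close>

lemma inc_cover_knuth_bac:
  fixes a b c :: "'a::linorder"
  assumes abc: "a < b" "b < c" and dist: "distinct (p @ [b, a, c] @ s)"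
    and cov: "inc_cover r N (p @ [b, a, c] @ s)"
  shows "inc_cover r N (p @ [b, c, a] @ s)"
proof -
  obtain f where f: "\<And>d. d < r \<Longrightarrow> sorted (filter (\<lambda>x. f x = d) (p @ [b, a, c] @ s))"
    and N: "N \<le> length (filter (\<lambda>x. f x < r) (p @ [b, a, c] @ s))"
    using cov unfolding inc_cover_def by blast
  consider (indep) "f a \<noteq> f c \<or> f a \<ge> r" | (free) "f a = f c" "f a < r" "f b \<ge> r"
    | (busy) "f a = f c" "f a < r" "f b < r" by linarith
  then show ?thesis
  proof cases
    case indep
    have "filter (\<lambda>x. f x = d) (p @ [b, c, a] @ s) = filter (\<lambda>x. f x = d) (p @ [b, a, c] @ s)"
      if "d < r" for d using indep that by auto
    then have "sorted (filter (\<lambda>x. f x = d) (p @ [b, c, a] @ s))" if "d < r" for d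
      using f[OF that] that by metis
    moreover have "N \<le> length (filter (\<lambda>x. f x < r) (p @ [b, c, a] @ s))"
      using N by (auto split: if_splits)
    ultimately show ?thesis unfolding inc_cover_def by blast
  next
    case free
    define g where "g = (\<lambda>x. if x = a then r else if x = b then f a else f x)"
    have gp: "filter (\<lambda>x. g x = d) p = filter (\<lambda>x. f x = d) p"
      "filter (\<lambda>x. g x = d) s = filter (\<lambda>x. f x = d) s"
      "filter (\<lambda>x. g x < r) p = filter (\<lambda>x. f x < r) p"
      "filter (\<lambda>x. g x < r) s = filter (\<lambda>x. f x < r) s" for d
      using dist by (auto simp: g_def intro!: filter_cong)
    have ne3: "a \<noteq> b" "b \<noteq> a" "a \<noteq> c" "c \<noteq> a" "b \<noteq> c" "c \<noteq> b"
      using abc by auto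
    have gabc: "g a = r" "g b = f a" "g c = f a"
      using ne3 free(1)[symmetric] by (simp_all add: g_def)
    have "sorted (filter (\<lambda>x. g x = d) (p @ [b, c, a] @ s))" if "d < r" for d
    proof (cases "d = f a")
      case True
      have "sorted (filter (\<lambda>x. f x = f a) p @ [a, c] @ filter (\<lambda>x. f x = f a) s)"
        using f[OF free(2)] free by simp
      then have "sorted (filter (\<lambda>x. f x = f a) p)" "sorted (filter (\<lambda>x. f x = f a) s)"
        and pa: "\<And>x. x \<in> set p \<Longrightarrow> f x = f a \<Longrightarrow> x \<le> a"
        and cs: "\<And>x. x \<in> set s \<Longrightarrow> f x = f a \<Longrightarrow> c \<le> x"
        and ps: "\<And>x y. x \<in> set p \<Longrightarrow> f x = f a \<Longrightarrow> y \<in> set s \<Longrightarrow> f y = f a \<Longrightarrow> x \<le> y"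
        by (auto simp: sorted_append)
      moreover have "x \<le> b" "x \<le> c" if "x \<in> set p" "f x = f a" for x
        using pa[OF that] abc by auto
      moreover have "b \<le> x" "a \<le> x" if "x \<in> set s" "f x = f a" for x
        using cs[OF that] abc by auto
      ultimately show ?thesis
        using True abc free by (simp add: gp gabc sorted_append)
    next
      case False
      then show ?thesis
        using f[OF that] free that by (auto simp: gp gabc split: if_splits)
    qed
    moreover have "N \<le> length (filter (\<lambda>x. g x < r) (p @ [b, c, a] @ s))"
      using N free by (simp add: gp gabc)
    ultimately show ?thesis unfolding inc_cover_def by blast
  next
    case busy
    have ne: "f b \<noteq> f a"
    proof
      assume "f b = f a"
      with f[OF busy(2)] abc show False by (auto simp: sorted_append)
    qed
    define \<tau> where "\<tau> = (\<lambda>d. if d = f a then f b else if d = f b then f a else d)"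
    define g where "g = (\<lambda>x. if x = c \<or> x \<in> set s then \<tau> (f x) else f x)"
    have tau: "\<tau> d < r \<longleftrightarrow> d < r" "\<tau> d = e \<longleftrightarrow> d = \<tau> e" for d e
      using busy by (auto simp: \<tau>_def)
    have gp: "filter (\<lambda>x. g x = d) p = filter (\<lambda>x. f x = d) p"
      "filter (\<lambda>x. g x = d) s = filter (\<lambda>x. f x = \<tau> d) s"
      "filter (\<lambda>x. g x < r) p = filter (\<lambda>x. f x < r) p"
      "filter (\<lambda>x. g x < r) s = filter (\<lambda>x. f x < r) s" for d
      using dist by (auto simp: g_def tau intro!: filter_cong)
    have gabc: "g a = f a" "g b = f b" "g c = f b"
      using abc busy dist by (auto simp: g_def \<tau>_def)
    have td: "\<tau> (f a) = f b" "\<tau> (f b) = f a" using ne by (auto simp: \<tau>_def)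
    have f_a: "sorted (filter (\<lambda>x. f x = f a) p @ [a, c] @ filter (\<lambda>x. f x = f a) s)"
      using f[OF busy(2)] busy ne by simp
    have f_b: "sorted (filter (\<lambda>x. f x = f b) p @ b # filter (\<lambda>x. f x = f b) s)"
      using f[OF busy(3)] busy ne by simp
    have fa: "sorted (filter (\<lambda>x. f x = f a) p)" "sorted (filter (\<lambda>x. f x = f a) s)"
      "\<And>x. x \<in> set p \<Longrightarrow> f x = f a \<Longrightarrow> x \<le> a" "\<And>x. x \<in> set s \<Longrightarrow> f x = f a \<Longrightarrow> c \<le> x"
      using f_a by (auto simp: sorted_append)
    have fa': "\<And>x. x \<in> set s \<Longrightarrow> f x = f a \<Longrightarrow> b \<le> x"
      using fa(4) abc by (meson less_imp_le order_trans)
    have fb: "sorted (filter (\<lambda>x. f x = f b) p)" "sorted (filter (\<lambda>x. f x = f b) s)"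
      "\<And>x. x \<in> set p \<Longrightarrow> f x = f b \<Longrightarrow> x \<le> b" "\<And>x. x \<in> set s \<Longrightarrow> f x = f b \<Longrightarrow> b \<le> x"
      using f_b by (auto simp: sorted_append)
    have fab: "x \<le> y" if "x \<in> set p" "f x = f a" "y \<in> set s" "f y = f b" for x y
      using fa(3)[OF that(1,2)] fb(4)[OF that(3,4)] abc(1) by (meson less_imp_le order_trans)
    have fba: "x \<le> y" if "x \<in> set p" "f x = f b" "y \<in> set s" "f y = f a" for x y
      using fa(4)[OF that(3,4)] fb(3)[OF that(1,2)] abc(2) by (meson less_imp_le order_trans)
    have fbc: "x \<le> c" if "x \<in> set p" "f x = f b" for x
      using fb(3)[OF that] abc(2) by (meson less_imp_le order_trans)
    have fab': "a \<le> y" if "y \<in> set s" "f y = f b" for y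
      using fb(4)[OF that] abc(1) by (meson less_imp_le order_trans)
    have fpb: "x \<le> b" if "x \<in> set p" "f x = f a" for x
      using fa(3)[OF that] abc(1) by (meson less_imp_le order_trans)
    have "sorted (filter (\<lambda>x. g x = d) (p @ [b, c, a] @ s))" if "d < r" for d
    proof -
      consider "d = f a" | "d = f b" | "d \<noteq> f a" "d \<noteq> f b" by blast
      then show ?thesis
      proof cases
        case 1
        show ?thesis
          using fa fb fa' fab fba fbc fab' fpb abc 1 ne by (auto simp: gp gabc td sorted_append)
      next
        case 2
        show ?thesis
          using fa fb fa' fab fba fbc fab' fpb abc 2 ne by (auto simp: gp gabc td sorted_append)
      next
        case 3
        then have td3: "\<tau> d = d" by (simp add: \<tau>_def)
        show ?thesis
          using f[OF that] 3 busy by (simp add: gp gabc td3)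
      qed
    qed
    moreover have "N \<le> length (filter (\<lambda>x. g x < r) (p @ [b, c, a] @ s))"
      using N busy by (simp add: gp gabc)
    ultimately show ?thesis unfolding inc_cover_def by blast
  qed
qed

text \<open>The mirror image of the argument for the other relation: an uncovered \<open>b\<close>
  now replaces \<open>c\<close> instead of \<open>a\<close>, and when the classes of
  \<open>a\<close> and \<open>b\<close> swap their tails, \<open>b\<close> belongs to the
  tail.\<close>

lemma inc_cover_knuth_acb:
  fixes a b c :: "'a::linorder"
  assumes abc: "a < b" "b < c" and dist: "distinct (p @ [a, c, b] @ s)"
    and cov: "inc_cover r N (p @ [a, c, b] @ s)"
  shows "inc_cover r N (p @ [c, a, b] @ s)"
proof -
  obtain f where f: "\<And>d. d < r \<Longrightarrow> sorted (filter (\<lambda>x. f x = d) (p @ [a, c, b] @ s))"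
    and N: "N \<le> length (filter (\<lambda>x. f x < r) (p @ [a, c, b] @ s))"
    using cov unfolding inc_cover_def by blast
  consider (indep) "f a \<noteq> f c \<or> f a \<ge> r" | (free) "f a = f c" "f a < r" "f b \<ge> r"
    | (busy) "f a = f c" "f a < r" "f b < r" by linarith
  then show ?thesis
  proof cases
    case indep
    have "filter (\<lambda>x. f x = d) (p @ [c, a, b] @ s) = filter (\<lambda>x. f x = d) (p @ [a, c, b] @ s)"
      if "d < r" for d using indep that by auto
    then have "sorted (filter (\<lambda>x. f x = d) (p @ [c, a, b] @ s))" if "d < r" for d
      using f[OF that] that by metis
    moreover have "N \<le> length (filter (\<lambda>x. f x < r) (p @ [c, a, b] @ s))"
      using N by (auto split: if_splits)
    ultimately show ?thesis unfolding inc_cover_def by blast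
  next
    case free
    define g where "g = (\<lambda>x. if x = c then r else if x = b then f a else f x)"
    have gp: "filter (\<lambda>x. g x = d) p = filter (\<lambda>x. f x = d) p"
      "filter (\<lambda>x. g x = d) s = filter (\<lambda>x. f x = d) s"
      "filter (\<lambda>x. g x < r) p = filter (\<lambda>x. f x < r) p"
      "filter (\<lambda>x. g x < r) s = filter (\<lambda>x. f x < r) s" for d
      using dist by (auto simp: g_def intro!: filter_cong)
    have ne3: "a \<noteq> b" "b \<noteq> a" "a \<noteq> c" "c \<noteq> a" "b \<noteq> c" "c \<noteq> b"
      using abc by auto
    have gabc: "g a = f a" "g b = f a" "g c = r"
      using ne3 free(1)[symmetric] by (simp_all add: g_def)
    have "sorted (filter (\<lambda>x. g x = d) (p @ [c, a, b] @ s))" if "d < r" for d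
    proof (cases "d = f a")
      case True
      have "sorted (filter (\<lambda>x. f x = f a) p @ [a, c] @ filter (\<lambda>x. f x = f a) s)"
        using f[OF free(2)] free by simp
      then have "sorted (filter (\<lambda>x. f x = f a) p)" "sorted (filter (\<lambda>x. f x = f a) s)"
        and pa: "\<And>x. x \<in> set p \<Longrightarrow> f x = f a \<Longrightarrow> x \<le> a"
        and cs: "\<And>x. x \<in> set s \<Longrightarrow> f x = f a \<Longrightarrow> c \<le> x"
        and ps: "\<And>x y. x \<in> set p \<Longrightarrow> f x = f a \<Longrightarrow> y \<in> set s \<Longrightarrow> f y = f a \<Longrightarrow> x \<le> y"
        by (auto simp: sorted_append)
      moreover have "x \<le> b" "x \<le> c" if "x \<in> set p" "f x = f a" for x
        using pa[OF that] abc by auto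
      moreover have "b \<le> x" "a \<le> x" if "x \<in> set s" "f x = f a" for x
        using cs[OF that] abc by auto
      ultimately show ?thesis
        using True abc free by (simp add: gp gabc sorted_append)
    next
      case False
      then show ?thesis
        using f[OF that] free that by (auto simp: gp gabc split: if_splits)
    qed
    moreover have "N \<le> length (filter (\<lambda>x. g x < r) (p @ [c, a, b] @ s))"
      using N free by (simp add: gp gabc)
    ultimately show ?thesis unfolding inc_cover_def by blast
  next
    case busy
    have ne: "f b \<noteq> f a"
    proof
      assume "f b = f a"
      with f[OF busy(2)] abc busy show False by (auto simp: sorted_append)
    qed
    define \<tau> where "\<tau> = (\<lambda>d. if d = f a then f b else if d = f b then f a else d)"
    have tau: "\<tau> d < r \<longleftrightarrow> d < r" "\<tau> d = e \<longleftrightarrow> d = \<tau> e" for d e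
      using busy by (auto simp: \<tau>_def)
    define g where "g = (\<lambda>x. if x = b \<or> x = c \<or> x \<in> set s then \<tau> (f x) else f x)"
    have gp: "filter (\<lambda>x. g x = d) p = filter (\<lambda>x. f x = d) p"
      "filter (\<lambda>x. g x = d) s = filter (\<lambda>x. f x = \<tau> d) s"
      "filter (\<lambda>x. g x < r) p = filter (\<lambda>x. f x < r) p"
      "filter (\<lambda>x. g x < r) s = filter (\<lambda>x. f x < r) s" for d
      using dist by (auto simp: g_def tau intro!: filter_cong)
    have gabc: "g a = f a" "g b = f a" "g c = f b"
      using abc busy dist ne by (auto simp: g_def \<tau>_def)
    have td: "\<tau> (f a) = f b" "\<tau> (f b) = f a" using ne by (auto simp: \<tau>_def)
    have f_a: "sorted (filter (\<lambda>x. f x = f a) p @ [a, c] @ filter (\<lambda>x. f x = f a) s)"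
      using f[OF busy(2)] busy ne by simp
    have f_b: "sorted (filter (\<lambda>x. f x = f b) p @ b # filter (\<lambda>x. f x = f b) s)"
      using f[OF busy(3)] busy ne by simp
    have fa: "sorted (filter (\<lambda>x. f x = f a) p)" "sorted (filter (\<lambda>x. f x = f a) s)"
      "\<And>x. x \<in> set p \<Longrightarrow> f x = f a \<Longrightarrow> x \<le> a" "\<And>x. x \<in> set s \<Longrightarrow> f x = f a \<Longrightarrow> c \<le> x"
      using f_a by (auto simp: sorted_append)
    have fa': "\<And>x. x \<in> set s \<Longrightarrow> f x = f a \<Longrightarrow> b \<le> x"
      using fa(4) abc by (meson less_imp_le order_trans)
    have fb: "sorted (filter (\<lambda>x. f x = f b) p)" "sorted (filter (\<lambda>x. f x = f b) s)"
      "\<And>x. x \<in> set p \<Longrightarrow> f x = f b \<Longrightarrow> x \<le> b" "\<And>x. x \<in> set s \<Longrightarrow> f x = f b \<Longrightarrow> b \<le> x"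
      using f_b by (auto simp: sorted_append)
    have fab: "x \<le> y" if "x \<in> set p" "f x = f a" "y \<in> set s" "f y = f b" for x y
      using fa(3)[OF that(1,2)] fb(4)[OF that(3,4)] abc(1) by (meson less_imp_le order_trans)
    have fba: "x \<le> y" if "x \<in> set p" "f x = f b" "y \<in> set s" "f y = f a" for x y
      using fa(4)[OF that(3,4)] fb(3)[OF that(1,2)] abc(2) by (meson less_imp_le order_trans)
    have fbc: "x \<le> c" if "x \<in> set p" "f x = f b" for x
      using fb(3)[OF that] abc(2) by (meson less_imp_le order_trans)
    have fab': "a \<le> y" if "y \<in> set s" "f y = f b" for y
      using fb(4)[OF that] abc(1) by (meson less_imp_le order_trans)
    have fpb: "x \<le> b" if "x \<in> set p" "f x = f a" for x
      using fa(3)[OF that] abc(1) by (meson less_imp_le order_trans)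
    have "sorted (filter (\<lambda>x. g x = d) (p @ [c, a, b] @ s))" if "d < r" for d
    proof -
      consider "d = f a" | "d = f b" | "d \<noteq> f a" "d \<noteq> f b" by blast
      then show ?thesis
      proof cases
        case 1
        show ?thesis
          using fa fb fa' fab fba fbc fab' fpb abc 1 ne by (auto simp: gp gabc td sorted_append)
      next
        case 2
        show ?thesis
          using fa fb fa' fab fba fbc fab' fpb abc 2 ne by (auto simp: gp gabc td sorted_append)
      next
        case 3
        then have td3: "\<tau> d = d" by (simp add: \<tau>_def)
        show ?thesis
          using f[OF that] 3 busy by (simp add: gp gabc td3)
      qed
    qed
    moreover have "N \<le> length (filter (\<lambda>x. g x < r) (p @ [c, a, b] @ s))"
      using N busy by (simp add: gp gabc)
    ultimately show ?thesis unfolding inc_cover_def by blast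
  qed
qed

text \<open>A class below \<open>r\<close> cannot contain both letters of the descent
  \<open>c\<close>, \<open>a\<close>, so their exchange leaves every such class unchanged. This
  serves as the converse direction for both Knuth relations.\<close>

lemma inc_cover_swap:
  fixes a c :: "'a::linorder"
  assumes "a < c" and cov: "inc_cover r N (p @ [c, a] @ s)"
  shows "inc_cover r N (p @ [a, c] @ s)"
proof -
  obtain f where f: "\<And>d. d < r \<Longrightarrow> sorted (filter (\<lambda>x. f x = d) (p @ [c, a] @ s))"
    and N: "N \<le> length (filter (\<lambda>x. f x < r) (p @ [c, a] @ s))"
    using cov unfolding inc_cover_def by blast
  have "filter (\<lambda>x. f x = d) (p @ [a, c] @ s) = filter (\<lambda>x. f x = d) (p @ [c, a] @ s)"
    if "d < r" for d using f[OF that] \<open>a < c\<close> by (auto simp: sorted_append)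
  then have "sorted (filter (\<lambda>x. f x = d) (p @ [a, c] @ s))" if "d < r" for d
    using f[OF that] that by metis
  moreover have "N \<le> length (filter (\<lambda>x. f x < r) (p @ [a, c] @ s))"
    using N by (auto split: if_splits)
  ultimately show ?thesis unfolding inc_cover_def by blast
qed

lemma inc_cover_knuth:
  assumes "knuth w w'" "distinct w"
  shows "inc_cover r N w \<longleftrightarrow> inc_cover r N w'"
  using assms
proof (induction rule: knuth.induct)
  case (bac a b c p s)
  then show ?case
    using inc_cover_knuth_bac[of a b c p s r N] inc_cover_swap[of a c r N "p @ [b]" s] by auto
next
  case (acb a b c p s)
  then show ?case
    using inc_cover_knuth_acb[of a b c p s r N] inc_cover_swap[of a c r N p "b # s"] by auto
qed

text \<open>The equality of multisets is part of the conclusion so that distinctness can be passed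
  along the chain of Knuth moves.\<close>

lemma equivclp_knuth_inc_cover:
  assumes "equivclp knuth w w'" "distinct w"
  shows "(inc_cover r N w \<longleftrightarrow> inc_cover r N w') \<and>
    (inc_cover r N (rev w) \<longleftrightarrow> inc_cover r N (rev w')) \<and> mset w = mset w'"
  using assms(1)
proof (induction rule: equivclp_induct)
  case base
  then show ?case by simp
next
  case (step y z)
  then have dy: "distinct y" using assms(2) by (metis mset_eq_imp_distinct_iff)
  have mz: "mset y = mset z" using step.hyps by (metis knuth_mset)
  then have dz: "distinct z" using dy by (metis mset_eq_imp_distinct_iff)
  have "(inc_cover r N y \<longleftrightarrow> inc_cover r N z) \<and>
    (inc_cover r N (rev y) \<longleftrightarrow> inc_cover r N (rev z))"
    using step.hyps inc_cover_knuth[of _ _ r N] dy dz knuth_rev[of y z] knuth_rev[of z y]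
    by (metis distinct_rev)
  then show ?case using step.IH mz by simp
qed

lemma equivclp_knuth_append:
  assumes "equivclp knuth w w'"
  shows "equivclp knuth (p @ w @ s) (p @ w' @ s)"
  using assms
proof (induction rule: equivclp_induct)
  case base
  then show ?case by simp
next
  case (step y z)
  then have "equivclp knuth (p @ y @ s) (p @ z @ s)"
    by (metis knuth_append r_into_equivclp equivclp_sym)
  then show ?case using step.IH by (rule equivclp_trans[rotated])
qed

section \<open>Row insertion and Knuth equivalence\<close>

lemma bump_cases:
  fixes x :: "'a::linorder"
  assumes "sorted_wrt (<) r" "x \<notin> set r"
  obtains "bump x r = (r @ [x], None)" "\<forall>y\<in>set r. y < x"
  | u y v where "r = u @ y # v" "bump x r = (u @ x # v, Some y)" "x < y" "\<forall>z\<in>set u. z < x"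
proof -
  have "(bump x r = (r @ [x], None) \<and> (\<forall>y\<in>set r. y < x)) \<or>
    (\<exists>u y v. r = u @ y # v \<and> bump x r = (u @ x # v, Some y) \<and> x < y \<and> (\<forall>z\<in>set u. z < x))"
    using assms
  proof (induction r)
    case Nil
    then show ?case by simp
  next
    case (Cons z r)
    show ?case
    proof (cases "x < z")
      case True
      then have "z # r = [] @ z # r \<and> bump x (z # r) = ([] @ x # r, Some z) \<and> x < z \<and> (\<forall>w\<in>set []. w < x)"
        by simp
      then show ?thesis by blast
    next
      case False
      then have zx: "z < x" using Cons.prems by auto
      consider "bump x r = (r @ [x], None)" "\<forall>y\<in>set r. y < x"
        | u y v where "r = u @ y # v" "bump x r = (u @ x # v, Some y)" "x < y" "\<forall>z\<in>set u. z < x"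
        using Cons by auto
      then show ?thesis
      proof cases
        case 1
        then show ?thesis using zx False by simp
      next
        case 2
        then have "z # r = (z # u) @ y # v \<and> bump x (z # r) = ((z # u) @ x # v, Some y) \<and> x < y \<and>
          (\<forall>w\<in>set (z # u). w < x)" using zx False by simp
        then show ?thesis by blast
      qed
    qed
  qed
  then show ?thesis using that by blast
qed

text \<open>\<open>x\<close> travels left through \<open>v\<close> until it stands behind the bumped
  \<open>y\<close>. It passes each \<open>z\<close> by the relation \<open>bac\<close> with
  \<open>l\<close>, \<open>x\<close>, \<open>z\<close> as \<open>b\<close>, \<open>a\<close>,
  \<open>c\<close>, where \<open>l\<close> is the letter before \<open>x\<close> and
  \<open>x < l < z\<close>.\<close>

lemma knuth_bump_left:
  fixes x y :: "'a::linorder"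
  assumes "sorted_wrt (<) (y # v)" "x < y"
  shows "equivclp knuth (y # v @ [x]) (y # x # v)"
  using assms
proof (induction v rule: rev_induct)
  case Nil
  then show ?case by simp
next
  case (snoc z v)
  obtain p l where pl: "y # v = p @ [l]" by (metis neq_Nil_conv rev_exhaust)
  have lz: "l < z" using snoc.prems pl by (metis append_Cons last_in_set last_snoc list.set_intros(1)
      sorted_wrt_append append_is_Nil_conv not_Cons_self2)
  have "y \<le> l" using snoc.prems pl
    by (metis append_Cons eq_refl last_in_set last_snoc less_imp_le list.distinct(1) set_ConsD
        sorted_wrt.simps(2) sorted_wrt_append)
  then have "x < l" using snoc.prems by simp
  then have "knuth (p @ [l, x, z] @ []) (p @ [l, z, x] @ [])" using lz by (rule knuth.bac)
  then have 1: "equivclp knuth (y # v @ [x, z]) (y # v @ [z, x])"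
    using pl r_into_equivclp[of knuth] by (metis append.assoc append_Cons append_Nil append_Nil2)
  have "equivclp knuth (y # v @ [x]) (y # x # v)"
    using snoc by (simp add: sorted_wrt_append)
  from equivclp_knuth_append[OF this, of "[]" "[z]"]
  have "equivclp knuth (y # v @ [x, z]) (y # x # v @ [z])" by simp
  then show ?case using 1 by (metis append.assoc append_Cons append_Nil equivclp_sym equivclp_trans)
qed

text \<open>\<open>y\<close> travels left over \<open>u\<close>. It passes each \<open>l\<close> by
  the relation \<open>acb\<close>, witnessed by the letter \<open>x\<close> behind \<open>y\<close>
  with \<open>l < x < y\<close>. After the move \<open>l\<close> takes over the role of
  \<open>x\<close>, hence the generalisation over \<open>x\<close> in the induction.\<close>

lemma knuth_bump_right:
  fixes x y :: "'a::linorder"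
  assumes "sorted_wrt (<) u" "\<forall>z\<in>set u. z < x" "x < y"
  shows "equivclp knuth (u @ [y, x]) (y # u @ [x])"
  using assms
proof (induction u arbitrary: x rule: rev_induct)
  case Nil
  then show ?case by simp
next
  case (snoc l u)
  have "equivclp knuth (u @ [y, l]) (y # u @ [l])"
    using snoc.prems by (intro snoc.IH) (auto simp: sorted_wrt_append)
  from equivclp_knuth_append[OF this, of "[]" "[x]"]
  have 1: "equivclp knuth (u @ [y, l, x]) (y # u @ [l, x])" by simp
  have "knuth (u @ [l, y, x] @ []) (u @ [y, l, x] @ [])"
    using snoc.prems by (intro knuth.acb) auto
  then have "equivclp knuth (u @ [l, y, x]) (u @ [y, l, x])" by (auto intro: r_into_equivclp)
  then show ?case using 1 by (metis append.assoc append_Cons append_Nil equivclp_trans)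
qed

section \<open>Tableaux and their reading words\<close>

definition reading :: "'a list list \<Rightarrow> 'a list" where
  "reading T = concat (rev T)"

lemma reading_simps [simp]:
  "reading [] = []" "reading (r # T) = reading T @ r"
  by (simp_all add: reading_def)

definition dominates :: "'a::linorder list \<Rightarrow> 'a list \<Rightarrow> bool" where
  "dominates r s \<longleftrightarrow> length s \<le> length r \<and> (\<forall>j<length s. r ! j < s ! j)"

text \<open>Transitivity reduces the pairwise condition in \<open>tableau\<close> to adjacent rows,
  the form in which row insertion is checked.\<close>

lemma transp_dominates: "transp dominates"
proof (rule transpI)
  fix r s t :: "'a list"
  assume rs: "dominates r s" and st: "dominates s t"
  show "dominates r t"
    unfolding dominates_def
  proof (intro conjI allI impI)
    show "length t \<le> length r" using rs st by (simp add: dominates_def)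
    fix j assume "j < length t"
    then have "r ! j < s ! j" "s ! j < t ! j" using rs st by (auto simp: dominates_def)
    then show "r ! j < t ! j" by (rule less_trans)
  qed
qed

definition tableau :: "'a::linorder list list \<Rightarrow> bool" where
  "tableau T \<longleftrightarrow> (\<forall>r\<in>set T. r \<noteq> [] \<and> sorted_wrt (<) r) \<and> sorted_wrt dominates T"

lemma tableau_Nil [simp]: "tableau []"
  by (simp add: tableau_def)

lemma tableau_single [simp]: "tableau [r] \<longleftrightarrow> r \<noteq> [] \<and> sorted_wrt (<) r"
  by (auto simp: tableau_def)

lemma tableau_Cons2 [simp]:
  "tableau (r # s # T) \<longleftrightarrow> r \<noteq> [] \<and> sorted_wrt (<) r \<and> dominates r s \<and> tableau (s # T)"
  unfolding tableau_def sorted_wrt2[OF transp_dominates] by auto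

lemma tableau_ConsD: "tableau (r # T) \<Longrightarrow> r \<noteq> [] \<and> sorted_wrt (<) r \<and> tableau T"
  by (auto simp: tableau_def)

lemma mset_row_insert: 
  fixes x :: "'a::linorder"
  shows "mset (concat (row_insert x T)) = add_mset x (mset (concat T))"
proof -
  have bump: "mset (fst (bump x r)) + (case snd (bump x r) of None \<Rightarrow> {#} | Some y \<Rightarrow> {#y#}) = add_mset x (mset r)"
    for x :: 'a and r
    by (induction r) (auto split: prod.splits option.splits)
  show ?thesis
  proof (induction T arbitrary: x)
    case Nil
    then show ?case by simp
  next
    case (Cons r T)
    show ?case using bump[of x r] Cons by (auto split: prod.splits option.splits)
  qed
qed

lemma mset_reading: "mset (reading T) = mset (concat T)"
  by (induction T) auto

text \<open>For a row \<open>u y v\<close>, Knuth moves turn \<open>u y v x\<close> into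
  \<open>u y x v\<close> and then into \<open>y u x v\<close>. Now \<open>y\<close> stands directly
  behind the reading word of the lower rows, ready for its insertion there.\<close>

lemma row_insert_knuth:
  fixes x :: "'a::linorder"
  assumes "tableau T" "distinct (concat T)" "x \<notin> set (concat T)"
  shows "equivclp knuth (reading T @ [x]) (reading (row_insert x T))"
  using assms
proof (induction T arbitrary: x)
  case Nil
  then show ?case by simp
next
  case (Cons r T)
  have r: "sorted_wrt (<) r" and T: "tableau T" using Cons.prems tableau_ConsD by auto
  have xr: "x \<notin> set r" using Cons.prems by simp
  show ?case
  proof (cases rule: bump_cases[OF r xr])
    case 1
    then show ?thesis by simp
  next
    case (2 u y v)
    have "equivclp knuth (reading T @ [y]) (reading (row_insert y T))"
      using T Cons.prems 2 by (intro Cons.IH) auto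
    from equivclp_knuth_append[OF this, of "[]" "u @ x # v"]
    have 3: "equivclp knuth (reading T @ y # u @ x # v) (reading (row_insert y T) @ u @ x # v)"
      by simp
    have "equivclp knuth (y # v @ [x]) (y # x # v)"
      using r 2 by (intro knuth_bump_left) (auto simp: sorted_wrt_append)
    from equivclp_knuth_append[OF this, of "reading T @ u" "[]"]
    have 1: "equivclp knuth (reading T @ u @ y # v @ [x]) (reading T @ u @ y # x # v)" by simp
    have "equivclp knuth (u @ [y, x]) (y # u @ [x])"
      using r 2 by (intro knuth_bump_right) (auto simp: sorted_wrt_append)
    from equivclp_knuth_append[OF this, of "reading T" "v"]
    have "equivclp knuth (reading T @ u @ y # x # v) (reading T @ y # u @ x # v)" by simp
    then show ?thesis using 1 3 2 by (auto intro: equivclp_trans)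
  qed
qed

text \<open>A bumped entry never moves right: in the column that \<open>y\<close> leaves,
  \<open>s\<close> has an entry larger than \<open>y\<close> or none. So \<open>y\<close> enters
  \<open>s\<close> in that column or further left, where the new upper row has a smaller
  entry.\<close>

lemma dominates_bump:
  fixes x :: "'a::linorder"
  assumes dom: "dominates (u @ y # v) s" and r: "sorted_wrt (<) (u @ y # v)" and "x < y"
    and s: "sorted_wrt (<) s" "y \<notin> set s"
  shows "dominates (u @ x # v) (fst (bump y s))"
proof -
  let ?r = "u @ y # v" and ?r' = "u @ x # v"
  have le: "?r' ! j \<le> ?r ! j" for j
    using \<open>x < y\<close> by (auto simp: nth_append nth_Cons split: nat.split)
  have len: "length s \<le> length ?r" and less: "\<And>j. j < length s \<Longrightarrow> ?r ! j < s ! j"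
    using dom by (auto simp: dominates_def)
  have s_less: "?r' ! j < s ! j" if "j < length s" for j
    using less[OF that] le[of j] by simp
  have y_less: "?r' ! j < y" if "j \<le> length u" for j
    using that r \<open>x < y\<close> by (cases "j = length u") (auto simp: nth_append sorted_wrt_append)
  have pos: "j \<le> length u" if "j \<le> length s" "\<forall>i<j. s ! i < y" for j
  proof (rule ccontr)
    assume "\<not> ?thesis"
    then have l: "length u < j" by simp
    have "?r ! length u < s ! length u" using less[of "length u"] l that by simp
    moreover have "s ! length u < y" using that l by simp
    ultimately show False by simp
  qed
  show ?thesis
  proof (cases rule: bump_cases[OF s])
    case 1
    have "length s \<le> length u" using pos[of "length s"] 1 by simp
    then show ?thesis
      using 1 y_less s_less by (auto simp: dominates_def less_Suc_eq nth_append)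
  next
    case (2 p z q)
    have "length p \<le> length u" using pos[of "length p"] 2 by (simp add: nth_append)
    moreover have "(p @ y # q) ! j = s ! j" if "j \<noteq> length p" for j
      using that 2 by (auto simp: nth_append nth_Cons split: nat.split)
    ultimately show ?thesis
      using 2 y_less s_less len unfolding dominates_def
      by (metis (no_types, lifting) fst_conv length_append length_Cons nth_append_length)
  qed
qed

lemma row_insert_hd:
  "row_insert x (r # T) = fst (bump x r) # (case snd (bump x r) of None \<Rightarrow> T | Some y \<Rightarrow> row_insert y T)"
  by (auto split: prod.splits option.splits)

lemma tableau_row_insert:
  fixes x :: "'a::linorder"
  assumes "tableau T" "distinct (concat T)" "x \<notin> set (concat T)"
  shows "tableau (row_insert x T)"
  using assms
proof (induction T arbitrary: x)
  case Nil
  then show ?case by simp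
next
  case (Cons r T)
  have r: "sorted_wrt (<) r" "r \<noteq> []" and T: "tableau T" using Cons.prems tableau_ConsD by auto
  have xr: "x \<notin> set r" using Cons.prems by simp
  show ?case
  proof (cases rule: bump_cases[OF r(1) xr])
    case 1
    have "sorted_wrt (<) (r @ [x])" using 1 r by (simp add: sorted_wrt_append)
    moreover have "dominates (r @ [x]) s" if "dominates r s" for s
      using that by (auto simp: dominates_def nth_append)
    ultimately show ?thesis using 1 Cons.prems(1) by (cases T) auto
  next
    case (2 u y v)
    have "tableau (row_insert y T)"
      using T Cons.prems 2 by (intro Cons.IH) auto
    moreover have "sorted_wrt (<) (u @ x # v)"
      using r 2 by (fastforce simp: sorted_wrt_append)
    moreover have "dominates (u @ x # v) (hd (row_insert y T))"
    proof (cases T)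
      case Nil
      have "u ! 0 < y" if "u \<noteq> []"
        using that 2 by (meson length_greater_0_conv less_trans nth_mem)
      then show ?thesis using 2 Nil by (auto simp: dominates_def nth_append)
    next
      case (Cons s T')
      then have "dominates (u @ x # v) (fst (bump y s))"
        using r 2 Cons.prems tableau_ConsD[of s T'] by (intro dominates_bump) auto
      then show ?thesis unfolding Cons row_insert_hd by simp
    qed
    moreover obtain s T' where "row_insert y T = s # T'"
      by (metis row_insert.simps(1) row_insert_hd neq_Nil_conv)
    ultimately show ?thesis using 2 by simp
  qed
qed

lemma insertion_tableau_props:
  fixes w :: "'a::linorder list"
  assumes "distinct w"
  shows "tableau (insertion_tableau w) \<and> mset (concat (insertion_tableau w)) = mset w \<and>
    equivclp knuth w (reading (insertion_tableau w))"
  using assms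
proof (induction w rule: rev_induct)
  case Nil
  then show ?case by (simp add: insertion_tableau_def)
next
  case (snoc x w)
  let ?T = "insertion_tableau w"
  have T: "tableau ?T" "mset (concat ?T) = mset w" "equivclp knuth w (reading ?T)"
    using snoc by auto
  have ins: "insertion_tableau (w @ [x]) = row_insert x ?T"
    by (simp add: insertion_tableau_def)
  have d: "distinct (concat ?T)" "x \<notin> set (concat ?T)"
    using T(2) snoc.prems by (metis distinct_append mset_eq_imp_distinct_iff)
      (metis T(2) distinct_append not_distinct_conv_prefix set_mset_mset snoc.prems)
  have "equivclp knuth (w @ [x]) (reading ?T @ [x])"
    using equivclp_knuth_append[OF T(3), of "[]" "[x]"] by simp
  then have "equivclp knuth (w @ [x]) (reading (row_insert x ?T))"
    using row_insert_knuth[OF T(1) d] by (rule equivclp_trans)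
  then show ?case
    unfolding ins using tableau_row_insert[OF T(1) d] mset_row_insert[of x ?T] T(2) by simp
qed

section \<open>Greene's theorem\<close>

text \<open>The rows are the increasing subsequences. The colour is the row index, so a new row on
  top shifts all other colours by one.\<close>

lemma inc_cover_rows:
  fixes T :: "'a::linorder list list"
  assumes "distinct (concat T)" "\<forall>r\<in>set T. sorted_wrt (<) r"
  shows "inc_cover a (sum_list (take a (map length T))) (reading T)"
  using assms
proof (induction T arbitrary: a)
  case Nil
  then show ?case by (simp add: inc_cover_def)
next
  case (Cons r T)
  show ?case
  proof (cases a)
    case 0
    then show ?thesis by (simp add: inc_cover_def)
  next
    case (Suc b)
    obtain f where f: "\<And>c. c < b \<Longrightarrow> sorted (filter (\<lambda>x. f x = c) (reading T))"
      and N: "sum_list (take b (map length T)) \<le> length (filter (\<lambda>x. f x < b) (reading T))"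
      using Cons.IH[of b] Cons.prems by (auto simp: inc_cover_def)
    define g where "g x = (if x \<in> set r then 0 else Suc (f x))" for x
    have set_T: "set (reading T) = set (concat T)" using mset_reading set_mset_mset by metis
    have disj: "x \<notin> set r" if "x \<in> set (reading T)" for x
      using that Cons.prems(1) unfolding set_T by auto
    have r: "filter (\<lambda>x. g x = 0) r = r" "filter (\<lambda>x. g x = Suc c) r = []"
      "filter (\<lambda>x. g x < a) r = r" for c
      using Suc by (auto simp: g_def filter_empty_conv intro!: filter_True)
    have T: "filter (\<lambda>x. g x = 0) (reading T) = []"
      "filter (\<lambda>x. g x = Suc c) (reading T) = filter (\<lambda>x. f x = c) (reading T)"
      "filter (\<lambda>x. g x < a) (reading T) = filter (\<lambda>x. f x < b) (reading T)" for c
      using Suc disj by (auto simp: g_def filter_empty_conv intro!: filter_cong)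
    have "sorted r" using Cons.prems(2) by (simp add: strict_sorted_imp_sorted)
    then have "sorted (filter (\<lambda>x. g x = c) (reading (r # T)))" if "c < a" for c
      using that Suc f by (cases c) (simp_all add: r T)
    moreover have "sum_list (take a (map length (r # T))) \<le> length (filter (\<lambda>x. g x < a) (reading (r # T)))"
      unfolding reading_simps filter_append length_append r T using N Suc by simp
    ultimately show ?thesis unfolding inc_cover_def by blast
  qed
qed

lemma filter_index:
  assumes "\<And>j. j < length r \<Longrightarrow> f (r ! j) = j"
  shows "filter (\<lambda>x. f x = c) r = (if c < length r then [r ! c] else [])"
    and "length (filter (\<lambda>x. f x < c) r) = min (length r) c"
proof -
  have upt: "filter (\<lambda>i. i < c) [0..<n] = [0..<min n c]" for n
  proof (induction n)
    case (Suc n)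
    then show ?case by (cases "n < c") (simp_all add: min_def)
  qed simp
  have eq: "filter (\<lambda>i. i = c) [0..<n] = (if c < n then [c] else [])" for n
    by (induction n) (auto)
  have "filter (\<lambda>x. f x = c) (map ((!) r) [0..<length r]) =
      map ((!) r) (filter (\<lambda>i. i = c) [0..<length r])"
    unfolding filter_map using assms by (auto intro!: arg_cong[of _ _ "map _"] filter_cong)
  then show "filter (\<lambda>x. f x = c) r = (if c < length r then [r ! c] else [])"
    by (simp add: map_nth eq split: if_splits)
  have "filter (\<lambda>x. f x < c) (map ((!) r) [0..<length r]) =
      map ((!) r) (filter (\<lambda>i. i < c) [0..<length r])"
    unfolding filter_map using assms by (auto intro!: arg_cong[of _ _ "map _"] filter_cong)
  then show "length (filter (\<lambda>x. f x < c) r) = min (length r) c"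
    by (simp add: map_nth upt)
qed

lemma column_function:
  assumes "distinct (concat T)"
  obtains f where "\<And>i j. i < length T \<Longrightarrow> j < length (T ! i) \<Longrightarrow> f (T ! i ! j) = j"
proof -
  have "\<exists>f. \<forall>r\<in>set T. \<forall>j<length r. f (r ! j) = j"
    using assms
  proof (induction T)
    case Nil
    then show ?case by simp
  next
    case (Cons r T)
    then obtain f where f: "\<forall>s\<in>set T. \<forall>j<length s. f (s ! j) = j" by auto
    define g where "g x = (if x \<in> set r then (THE j. j < length r \<and> r ! j = x) else f x)" for x
    have "g (r ! j) = j" if "j < length r" for j
      using Cons.prems that unfolding g_def by (auto simp: nth_eq_iff_index_eq)
    moreover have "g (s ! j) = j" if "s \<in> set T" "j < length s" for s j
    proof -
      have "s ! j \<notin> set r" using Cons.prems that by (auto dest!: nth_mem)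
      then show ?thesis using f that by (simp add: g_def)
    qed
    ultimately show ?case by auto
  qed
  then show thesis using that nth_mem by blast
qed

text \<open>The columns are the classes: the reversed reading word lists the rows from top to
  bottom, so each column appears in increasing order. The sum counts the cells in the first
  \<open>b\<close> columns row by row.\<close>

lemma inc_cover_columns:
  fixes T :: "'a::linorder list list"
  assumes "distinct (concat T)" "sorted_wrt dominates T"
  shows "inc_cover b (sum_list (map (\<lambda>r. min (length r) b) T)) (rev (reading T))"
proof -
  obtain f where f: "\<And>i j. i < length T \<Longrightarrow> j < length (T ! i) \<Longrightarrow> f (T ! i ! j) = j"
    using column_function[OF assms(1)] by blast
  then have f: "f (r ! j) = j" if "r \<in> set T" "j < length r" for r j
    using that by (metis in_set_conv_nth)
  have rev_reading: "rev (reading T) = concat (map rev T)"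
    by (induction T) auto
  have "sorted (filter (\<lambda>x. f x = c) (concat (map rev T))) \<and>
    (\<forall>x\<in>set (filter (\<lambda>x. f x = c) (concat (map rev T))). \<exists>r\<in>set T. c < length r \<and> x = r ! c)" for c
    using f assms(2)
  proof (induction T)
    case Nil
    then show ?case by simp
  next
    case (Cons r T)
    have r: "filter (\<lambda>x. f x = c) (rev r) = (if c < length r then [r ! c] else [])"
      using filter_index(1)[of r f c] Cons.prems(1) by (simp flip: rev_filter)
    have IH: "sorted (filter (\<lambda>x. f x = c) (concat (map rev T))) \<and>
    (\<forall>x\<in>set (filter (\<lambda>x. f x = c) (concat (map rev T))). \<exists>r\<in>set T. c < length r \<and> x = r ! c)"
      using Cons by auto
    then have "r ! c \<le> x" if "x \<in> set (filter (\<lambda>x. f x = c) (concat (map rev T)))" for x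
      using that Cons.prems(2) by (auto simp: dominates_def less_imp_le simp del: set_filter)
    then show ?case using IH r by (auto simp del: set_filter)
  qed
  moreover have "sum_list (map (\<lambda>r. min (length r) b) T) = length (filter (\<lambda>x. f x < b) (concat (map rev T)))"
    using f
  proof (induction T)
    case Nil
    then show ?case by simp
  next
    case (Cons r T)
    have "length (filter (\<lambda>x. f x < b) (rev r)) = min (length r) b"
      using filter_index(2)[of r f b] Cons.prems(1) by (simp flip: rev_filter)
    then show ?case using Cons by simp
  qed
  ultimately show ?thesis unfolding inc_cover_def rev_reading by (metis le_refl)
qed

lemma sum_list_take_length:
  "sum_list (take r (map length T)) = (\<Sum>i<min r (length T). length (T ! i))"
  by (simp add: sum_list_sum_nth atLeast0LessThan min.commute)

lemma sorted_rev_unique: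
  fixes l :: "'a::linorder list"
  assumes up: "sorted_wrt (<) l" and down: "sorted (rev l)" and xy: "x \<in> set l" "y \<in> set l"
  shows "x = y"
proof (rule ccontr)
  assume "x \<noteq> y"
  obtain i j where ij: "i < length l" "l ! i = x" "j < length l" "l ! j = y"
    using xy by (metis in_set_conv_nth)
  then have "i \<noteq> j" using \<open>x \<noteq> y\<close> by auto
  moreover have "sorted_wrt (\<ge>) l" using down by (simp add: sorted_wrt_rev)
  ultimately show False
    using ij sorted_wrt_nth_less[OF up, of i j] sorted_wrt_nth_less[OF up, of j i]
      sorted_wrt_nth_less[of "(\<ge>)" l i j] sorted_wrt_nth_less[of "(\<ge>)" l j i]
    by (cases i j rule: linorder_cases) auto
qed

text \<open>A row is increasing, so it meets each of the \<open>c\<close> decreasing classes at most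
  once.\<close>

lemma inc_cover_rev_upper:
  fixes T :: "'a::linorder list list"
  assumes "tableau T" and cov: "inc_cover c N (rev (reading T))"
  shows "N \<le> sum_list (map (\<lambda>r. min (length r) c) T)"
proof -
  obtain f where f: "\<And>d. d < c \<Longrightarrow> sorted (filter (\<lambda>x. f x = d) (rev (reading T)))"
    and N: "N \<le> length (filter (\<lambda>x. f x < c) (rev (reading T)))"
    using cov unfolding inc_cover_def by blast
  have "length (filter (\<lambda>x. f x < c) (rev (reading T))) \<le> sum_list (map (\<lambda>r. min (length r) c) T)"
    using assms(1) f
  proof (induction T)
    case Nil
    then show ?case by simp
  next
    case (Cons r T)
    have r: "sorted_wrt (<) r" and T: "tableau T" using Cons.prems tableau_ConsD by auto
    have sT: "\<And>d. d < c \<Longrightarrow> sorted (filter (\<lambda>x. f x = d) (rev (reading T)))"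
      and sr: "\<And>d. d < c \<Longrightarrow> sorted (filter (\<lambda>x. f x = d) (rev r))"
      using Cons.prems(2) by (auto simp: sorted_append)
    let ?F = "{x \<in> set r. f x < c}"
    have "inj_on f ?F"
    proof (rule inj_onI, rule ccontr)
      fix x y assume xy: "x \<in> ?F" "y \<in> ?F" "f x = f y" "x \<noteq> y"
      let ?l = "filter (\<lambda>z. f z = f x) r"
      have "sorted (rev ?l)" using sr[of "f x"] xy by (simp add: rev_filter)
      moreover have "sorted_wrt (<) ?l" using r by (rule sorted_wrt_filter)
      moreover have "x \<in> set ?l" "y \<in> set ?l" using xy by auto
      ultimately have "x = y" by (intro sorted_rev_unique[of ?l])
      then show False using xy(4) by simp
    qed
    then have "card ?F \<le> c"
      using card_inj_on_le[of f ?F "{..<c}"] by auto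
    moreover have "length (filter (\<lambda>x. f x < c) r) = card ?F"
      using r by (metis distinct_card distinct_filter set_filter strict_sorted_iff)
    moreover have "length (filter (\<lambda>x. f x < c) r) \<le> length r" by simp
    ultimately have "length (filter (\<lambda>x. f x < c) (rev r)) \<le> min (length r) c"
      by (simp flip: rev_filter del: length_filter_le)
    then show ?case using add_mono[OF _ Cons.IH[OF T sT]] by simp
  qed
  then show ?thesis using N by simp
qed

lemma reading_append: "reading (A @ B) = reading B @ reading A"
  by (simp add: reading_def)

text \<open>A column is a decreasing subsequence of the reading word, so it meets each of the
  \<open>r\<close> increasing classes at most once. It therefore has at most as many covered entries
  as it has cells in the first \<open>r\<close> rows.\<close>

lemma inc_cover_upper:
  fixes T :: "'a::linorder list list"
  assumes T: "tableau T" and dist: "distinct (concat T)" and cov: "inc_cover r N (reading T)"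
  shows "N \<le> sum_list (take r (map length T))"
proof -
  obtain f where f: "\<And>d. d < r \<Longrightarrow> sorted (filter (\<lambda>x. f x = d) (reading T))"
    and N: "N \<le> length (filter (\<lambda>x. f x < r) (reading T))"
    using cov unfolding inc_cover_def by blast
  have set_T: "set (reading T) = set (concat T)" and dist': "distinct (reading T)"
    using mset_reading[of T] dist by (metis set_mset_mset, metis mset_eq_imp_distinct_iff)
  have dom: "dominates (T ! i) (T ! i')" if "i < i'" "i' < length T" for i i'
    using T that by (simp add: tableau_def sorted_wrt_iff_nth_less)
  \<comment> \<open>\<open>L\<close> exceeds every row length, so the columns can be indexed by a
    finite range.\<close>
  define L where "L = Suc (sum_list (map length T))"
  have L: "length (T ! i) < L" if "i < length T" for i
    using that unfolding L_def by (auto simp: less_Suc_eq_le intro!: member_le_sum_list)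
  \<comment> \<open>The covered cells and the cells of the first \<open>r\<close> rows are compared
    column by column.\<close>
  define A where "A j = {i. i < length T \<and> j < length (T ! i) \<and> f (T ! i ! j) < r}" for j
  define B where "B j = {i. i < min r (length T) \<and> j < length (T ! i)}" for j
  have fin: "finite (A j)" "finite (B j)" for j by (auto simp: A_def B_def)
  have AB: "card (A j) \<le> card (B j)" for j
  proof (cases "\<forall>i<length T. j < length (T ! i) \<longrightarrow> i < r")
    case True
    then have "A j \<subseteq> B j" by (auto simp: A_def B_def)
    then show ?thesis using fin card_mono by blast
  next
    case False
    then obtain i where i: "i < length T" "j < length (T ! i)" "r \<le> i" by auto
    then have "j < length (T ! i')" if "i' < r" for i'
      using dom[of i' i] that by (auto simp: dominates_def)
    then have "B j = {..<r}" using i by (auto simp: B_def)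
    moreover have "inj_on (\<lambda>i. f (T ! i ! j)) (A j)"
    proof -
      have "f (T ! i ! j) \<noteq> f (T ! i' ! j)" if ii: "i \<in> A j" "i' \<in> A j" "i < i'" for i i'
      proof
        assume eq: "f (T ! i ! j) = f (T ! i' ! j)"
        have i': "i' < length T" "j < length (T ! i')" "f (T ! i' ! j) < r" and i: "j < length (T ! i)"
          using ii by (auto simp: A_def)
        \<comment> \<open>Lower rows come first in the reading word, so equal colours would force
          the lower entry of a column to be at most the upper one.\<close>
        have "T = take i T @ T ! i # drop (Suc i) T"
          using i' ii(3) by (simp add: id_take_nth_drop)
        then have rd: "reading T = reading (drop (Suc i) T) @ T ! i @ reading (take i T)"
          by (metis append.assoc reading_append reading_simps(2))
        have "T ! i' \<in> set (drop (Suc i) T)"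
          using i' ii(3) nth_mem[of "i' - Suc i" "drop (Suc i) T"] by simp
        then have "T ! i' ! j \<in> set (reading (drop (Suc i) T))"
          using i'(2) nth_mem[of j "T ! i'"] by (auto simp: reading_def simp del: nth_mem)
        moreover have "T ! i ! j \<in> set (T ! i)" using i by simp
        ultimately have "T ! i' ! j \<le> T ! i ! j"
          using f[OF i'(3)] eq by (auto simp: rd sorted_append)
        moreover have "T ! i ! j < T ! i' ! j" using dom[OF ii(3) i'(1)] i'(2) by (simp add: dominates_def)
        ultimately show False by simp
      qed
      then show ?thesis by (metis (mono_tags, lifting) inj_onI linorder_neqE_nat)
    qed
    then have "card (A j) \<le> card {..<r}"
      by (rule card_inj_on_le) (auto simp: A_def)
    ultimately show ?thesis by simp
  qed
  have "length (filter (\<lambda>x. f x < r) (reading T)) = card {x \<in> set (reading T). f x < r}"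
    using dist' by (metis distinct_card distinct_filter set_filter)
  also have "\<dots> \<le> card (Sigma {..<L} A)"
  proof (rule surj_card_le)
    show "finite (Sigma {..<L} A)" using fin by auto
    show "{x \<in> set (reading T). f x < r} \<subseteq> (\<lambda>(j, i). T ! i ! j) ` Sigma {..<L} A"
    proof
      fix x assume "x \<in> {x \<in> set (reading T). f x < r}"
      then obtain i j where ij: "i < length T" "j < length (T ! i)" "x = T ! i ! j" "f x < r"
        unfolding set_T by (auto simp: in_set_conv_nth)
      then have "(j, i) \<in> Sigma {..<L} A" using L[OF ij(1)] by (auto simp: A_def)
      then show "x \<in> (\<lambda>(j, i). T ! i ! j) ` Sigma {..<L} A" using ij(3) by (metis case_prod_conv imageI)
    qed
  qed
  also have "\<dots> = (\<Sum>j<L. card (A j))" using fin by simp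
  also have "\<dots> \<le> (\<Sum>j<L. card (B j))" using AB by (rule sum_mono)
  also have "\<dots> = card (Sigma {..<L} B)" using fin by simp
  also have "\<dots> = card (Sigma {..<min r (length T)} (\<lambda>i. {..<length (T ! i)}))"
    by (rule bij_betw_same_card[of prod.swap])
      (force simp: bij_betw_def inj_on_def B_def image_iff dest: L)
  also have "\<dots> = sum_list (take r (map length T))"
    by (simp add: sum_list_take_length)
  finally show ?thesis using N by simp
qed

text \<open>Greene's theorem: the partial row and column sums of the shape are the largest sizes of
  covers by \<open>a\<close> increasing and by \<open>a\<close> decreasing subsequences. Knuth
  equivalence transfers this from the reading word of the insertion tableau to
  \<open>w\<close>.\<close>

lemma rs_shape_greene:
  fixes w :: "'a::linorder list"
  assumes "distinct w"
  shows "is_partition (rs_shape w)" "sum_list (rs_shape w) = length w"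
    and "inc_cover a (sum_list (take a (rs_shape w))) w"
    and "inc_cover a (sum_list (map (\<lambda>l. min l a) (rs_shape w))) (rev w)"
    and "inc_cover a N w \<Longrightarrow> N \<le> sum_list (take a (rs_shape w))"
    and "inc_cover a N (rev w) \<Longrightarrow> N \<le> sum_list (map (\<lambda>l. min l a) (rs_shape w))"
proof -
  define T where "T = insertion_tableau w"
  have T: "tableau T" "mset (concat T) = mset w" "equivclp knuth w (reading T)"
    using insertion_tableau_props[OF assms] by (auto simp: T_def)
  have dist: "distinct (concat T)" using T(2) assms by (metis mset_eq_imp_distinct_iff)
  have shape: "rs_shape w = map length T" by (simp add: rs_shape_def T_def)
  have cov: "inc_cover a N w \<longleftrightarrow> inc_cover a N (reading T)"
    "inc_cover a N (rev w) \<longleftrightarrow> inc_cover a N (rev (reading T))" for a N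
    using equivclp_knuth_inc_cover[OF T(3) assms] by auto
  show "is_partition (rs_shape w)"
    using T(1) unfolding is_partition_def shape tableau_def
    by (auto simp: sorted_wrt_map dominates_def elim: sorted_wrt_mono_rel[rotated])
  show "sum_list (rs_shape w) = length w"
    using arg_cong[OF T(2), of size] by (simp add: shape length_concat)
  show "inc_cover a (sum_list (take a (rs_shape w))) w"
    unfolding cov shape using inc_cover_rows[OF dist] T(1) by (auto simp: tableau_def)
  show "inc_cover a (sum_list (map (\<lambda>l. min l a) (rs_shape w))) (rev w)"
    unfolding cov shape using inc_cover_columns[OF dist, of a] T(1)
    by (auto simp: tableau_def comp_def)
  show "inc_cover a N w \<Longrightarrow> N \<le> sum_list (take a (rs_shape w))"
    unfolding cov shape using inc_cover_upper[OF T(1) dist] .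
  show "inc_cover a N (rev w) \<Longrightarrow> N \<le> sum_list (map (\<lambda>l. min l a) (rs_shape w))"
    unfolding cov shape using inc_cover_rev_upper[OF T(1)] by (simp add: comp_def)
qed

section \<open>Recovering a partition from its partial row and column sums\<close>

lemma sum_list_excess:
  fixes l :: "nat list"
  shows "sum_list (map (\<lambda>x. min x c) l) + sum_list (map (\<lambda>x. x - c) l) = sum_list l"
  by (induction l) auto

lemma sum_list_take_le_excess:
  fixes l :: "nat list"
  shows "sum_list (take r l) \<le> sum_list (map (\<lambda>x. x - c) l) + r * c"
proof (induction l arbitrary: r)
  case Nil
  then show ?case by simp
next
  case (Cons x l)
  show ?case
  proof (cases r)
    case (Suc q)
    then show ?thesis using Cons[of q] by simp
  qed simp
qed

text \<open>Equality in the preceding bound holds when \<open>r\<close> is the number of parts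
  exceeding \<open>c\<close>. So the excess over \<open>c\<close> is the maximum over
  \<open>r\<close> of the sum of the first \<open>r\<close> parts minus
  \<open>r * c\<close>.\<close>

lemma sum_list_take_eq_excess:
  fixes l :: "nat list"
  assumes "sorted_wrt (\<ge>) l"
  obtains r where "sum_list (map (\<lambda>x. x - c) l) + r * c = sum_list (take r l)"
proof -
  have "\<exists>r. sum_list (map (\<lambda>x. x - c) l) + r * c = sum_list (take r l)"
    using assms
  proof (induction l)
    case Nil
    then show ?case by (auto intro: exI[of _ 0])
  next
    case (Cons x l)
    show ?case
    proof (cases "c < x")
      case True
      obtain r where "sum_list (map (\<lambda>x. x - c) l) + r * c = sum_list (take r l)"
        using Cons by auto
      then have "sum_list (map (\<lambda>x. x - c) (x # l)) + Suc r * c = sum_list (take (Suc r) (x # l))"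
        using True by simp
      then show ?thesis by blast
    next
      case False
      have "sum_list (map (\<lambda>x. x - c) l) = 0"
        using Cons.prems False by (auto simp: sum_list_eq_0_iff)
      then show ?thesis using False by (intro exI[of _ 0]) simp
    qed
  qed
  then show thesis using that by blast
qed

text \<open>Antisymmetry of the dominance order. Larger column sums leave \<open>l\<close> a smaller
  excess over every \<open>c\<close>; larger row sums give it a larger one, the excess being a
  maximum of row sums minus \<open>r * c\<close>. Equal excesses determine the parts.\<close>

lemma partition_eqI:
  assumes l: "is_partition l" and m: "is_partition m" and sum: "sum_list l = sum_list m"
    and rows: "\<And>r. sum_list (take r m) \<le> sum_list (take r l)"
    and cols: "\<And>c. sum_list (map (\<lambda>x. min x c) m) \<le> sum_list (map (\<lambda>x. min x c) l)"
  shows "l = m"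
proof -
  define E where "E c l = sum_list (map (\<lambda>x. x - c) l)" for c and l :: "nat list"
  have E: "E c l = E c m" for c
  proof (rule antisym)
    show "E c l \<le> E c m"
      using sum cols[of c] sum_list_excess[of c l] sum_list_excess[of c m] by (simp add: E_def)
    obtain r where "E c m + r * c = sum_list (take r m)"
      using sum_list_take_eq_excess m unfolding E_def is_partition_def by metis
    also have "\<dots> \<le> sum_list (take r l)" by (rule rows)
    also have "\<dots> \<le> E c l + r * c" unfolding E_def by (rule sum_list_take_le_excess)
    finally show "E c m \<le> E c l" by simp
  qed
  \<comment> \<open>The second difference of \<open>x - c\<close> in \<open>c\<close> is 1 at
    \<open>c = x\<close> and 0 elsewhere; \<open>v > 0\<close> keeps \<open>v - 1\<close> from
    truncating.\<close>
  have count: "count (mset l) v = E (v - 1) l + E (v + 1) l - 2 * E v l" if "v > 0" for v l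
    using that
  proof (induction l)
    case Nil
    then show ?case by (simp add: E_def)
  next
    case (Cons x l)
    have v: "v > 0" using Cons.prems .
    \<comment> \<open>Convexity makes the subtraction of natural numbers in the claim exact.\<close>
    have "2 * E v l \<le> E (v - 1) l + E (v + 1) l"
    proof (induction l)
      case (Cons y l)
      have "2 * (y - v) \<le> (y - (v - 1)) + (y - (v + 1))" using v by arith
      from add_mono[OF this Cons.IH] show ?case
        by (simp only: E_def list.map sum_list.Cons distrib_left ac_simps)
    qed (simp add: E_def)
    moreover have "(if x = v then 1 else 0) + 2 * (x - v) = (x - (v - 1)) + (x - (v + 1))"
      using Cons.prems by auto
    ultimately show ?case
      using Cons.IH[OF Cons.prems] by (auto simp: E_def)
  qed
  have "count (mset l) v = count (mset m) v" for v
  proof (cases "v = 0")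
    case True
    then have "v \<notin># mset l" "v \<notin># mset m" using l m by (auto simp: is_partition_def)
    then show ?thesis by (metis not_in_iff)
  qed (simp add: count E)
  then have "mset (rev l) = mset (rev m)" by (simp add: multiset_eq_iff)
  moreover have "sorted (rev l)" "sorted (rev m)"
    using l m by (auto simp: is_partition_def sorted_wrt_rev)
  ultimately have "rev l = rev m" by (metis properties_for_sort)
  then show ?thesis by simp
qed

section \<open>Grids and patterns\<close>

text \<open>\<open>(a, b)\<close> is a point of the boundary path: the first \<open>a\<close> rows
  and the first \<open>b\<close> columns cover the diagram and overlap in the full rectangle of
  \<open>a\<close> rows and \<open>b\<close> columns.\<close>

lemma corner_sum:
  fixes l :: "nat list"
  assumes "a \<le> length l" "\<forall>i<a. b \<le> l ! i" "\<forall>i<length l. a \<le> i \<longrightarrow> l ! i \<le> b"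
  shows "sum_list (take a l) + sum_list (map (\<lambda>x. min x b) l) = sum_list l + a * b"
  using assms
proof (induction l arbitrary: a)
  case Nil
  then show ?case by simp
next
  case (Cons x l)
  show ?case
  proof (cases a)
    case 0
    have "map (\<lambda>x. min x b) (x # l) = x # l"
      using Cons.prems(3) 0 unfolding all_set_conv_all_nth[symmetric]
      by (intro map_idI) (metis in_set_conv_nth min.absorb1 zero_le)
    then show ?thesis using 0 by simp
  next
    case (Suc a')
    have "\<forall>i<a'. b \<le> l ! i" using Cons.prems(2) Suc by (metis Suc_less_eq nth_Cons_Suc)
    moreover have "\<forall>i<length l. a' \<le> i \<longrightarrow> l ! i \<le> b"
      using Cons.prems(3) Suc by (metis Suc_le_mono Suc_less_eq length_Cons nth_Cons_Suc)
    moreover have "b \<le> x" using Cons.prems(2) Suc by (metis nth_Cons_0 zero_less_Suc)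
    ultimately show ?thesis using Cons.IH[of a'] Cons.prems(1) Suc by simp
  qed
qed

text \<open>The sizes of the two covers add up to at least \<open>length w + a * b\<close>. Their
  union has at most \<open>length w\<close> entries, and their overlap at most \<open>a * b\<close>,
  since an increasing and a decreasing class share at most one entry. So both bounds are
  attained.\<close>

lemma greene_split:
  fixes w :: "'a::linorder list"
  assumes dist: "distinct w" and a: "a \<le> length (rs_shape w)"
    and ge: "\<forall>i<a. b \<le> rs_shape w ! i"
    and le: "\<forall>i<length (rs_shape w). a \<le> i \<longrightarrow> rs_shape w ! i \<le> b"
  obtains f g :: "'a \<Rightarrow> nat"
  where "\<And>c. c < a \<Longrightarrow> sorted (filter (\<lambda>x. f x = c) w)"
    and "\<And>d. d < b \<Longrightarrow> sorted (filter (\<lambda>x. g x = d) (rev w))"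
    and "\<And>x. x \<in> set w \<Longrightarrow> f x < a \<or> g x < b"
    and "bij_betw (\<lambda>x. (f x, g x)) {x \<in> set w. f x < a \<and> g x < b} ({..<a} \<times> {..<b})"
proof -
  let ?l = "rs_shape w"
  obtain f where f: "\<And>c. c < a \<Longrightarrow> sorted (filter (\<lambda>x. f x = c) w)"
    and N: "sum_list (take a ?l) \<le> length (filter (\<lambda>x. f x < a) w)"
    using rs_shape_greene(3)[OF dist, of a] unfolding inc_cover_def by blast
  obtain g where g: "\<And>d. d < b \<Longrightarrow> sorted (filter (\<lambda>x. g x = d) (rev w))"
    and M: "sum_list (map (\<lambda>l. min l b) ?l) \<le> length (filter (\<lambda>x. g x < b) (rev w))"
    using rs_shape_greene(4)[OF dist, of b] unfolding inc_cover_def by blast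
  define C where "C = {x \<in> set w. f x < a}"
  define D where "D = {x \<in> set w. g x < b}"
  have fin: "finite C" "finite D" by (auto simp: C_def D_def)
  have "length (filter P w) = card {x \<in> set w. P x}" for P
    using dist by (metis distinct_card distinct_filter set_filter)
  then have NC: "sum_list (take a ?l) \<le> card C" and MD: "sum_list (map (\<lambda>l. min l b) ?l) \<le> card D"
    using N M by (simp_all add: C_def D_def flip: rev_filter)
  let ?h = "\<lambda>x. (f x, g x)"
  have inj: "inj_on ?h (C \<inter> D)"
  proof (rule inj_onI)
    fix x y assume xy: "x \<in> C \<inter> D" "y \<in> C \<inter> D" "?h x = ?h y"
    let ?k = "filter (\<lambda>z. g z = g x) (filter (\<lambda>z. f z = f x) w)"
    have "sorted (filter (\<lambda>z. f z = f x) w)" using f xy by (auto simp: C_def)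
    then have "sorted ?k" by (rule sorted_wrt_filter)
    moreover have "distinct ?k" using dist by simp
    ultimately have "sorted_wrt (<) ?k" by (simp add: strict_sorted_iff)
    moreover have "rev ?k = filter (\<lambda>z. f z = f x) (filter (\<lambda>z. g z = g x) (rev w))"
      by (simp add: rev_filter conj_commute)
    moreover have "sorted (filter (\<lambda>z. f z = f x) (filter (\<lambda>z. g z = g x) (rev w)))"
      using xy by (intro sorted_wrt_filter g) (auto simp: D_def)
    ultimately show "x = y"
      using xy by (intro sorted_rev_unique[of ?k]) (auto simp: C_def)
  qed
  have sub: "?h ` (C \<inter> D) \<subseteq> {..<a} \<times> {..<b}" by (auto simp: C_def D_def)
  have ab: "card (C \<inter> D) \<le> a * b"
    using card_inj_on_le[OF inj sub] by simp
  have "card C + card D = card (C \<union> D) + card (C \<inter> D)" using fin by (rule card_Un_Int)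
  moreover have cw: "card (C \<union> D) \<le> card (set w)" by (rule card_mono) (auto simp: C_def D_def)
  moreover have "card (set w) = sum_list ?l"
    using rs_shape_greene(2)[OF dist] dist by (simp add: distinct_card)
  ultimately have eq: "card (C \<union> D) = card (set w)" "card (C \<inter> D) = a * b"
    using NC MD corner_sum[OF a ge le] ab by linarith+
  have "C \<union> D = set w"
    using eq(1) by (intro card_subset_eq) (auto simp: C_def D_def)
  then have "f x < a \<or> g x < b" if "x \<in> set w" for x
    using that by (auto simp: C_def D_def)
  moreover have "?h ` (C \<inter> D) = {..<a} \<times> {..<b}"
    using sub eq(2) card_image[OF inj] by (intro card_subset_eq) auto
  then have "bij_betw ?h {x \<in> set w. f x < a \<and> g x < b} ({..<a} \<times> {..<b})"
    using inj by (auto simp: bij_betw_def C_def D_def Int_def cong: conj_cong)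
  ultimately show thesis using that f g by blast
qed

text \<open>On the grid points indexed by the diagram of \<mu>, \<open>f\<close> is the row index
  and \<open>g\<close> the column index. This gives covers as large as the partial sums of \<mu> in
  both directions, and \<open>partition_eqI\<close> forces the shape.\<close>

lemma grid_pattern:
  fixes w :: "'a::linorder list" and f g :: "'a \<Rightarrow> nat"
  assumes dist: "distinct w" and \<mu>: "is_partition \<mu>" "length \<mu> \<le> a" "\<forall>i<length \<mu>. \<mu> ! i \<le> b"
    and f: "\<And>c. c < a \<Longrightarrow> sorted (filter (\<lambda>x. f x = c) w)"
    and g: "\<And>d. d < b \<Longrightarrow> sorted (filter (\<lambda>x. g x = d) (rev w))"
    and bij: "bij_betw (\<lambda>x. (f x, g x)) {x \<in> set w. f x < a \<and> g x < b} ({..<a} \<times> {..<b})"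
  shows "rs_shape (filter (\<lambda>x. f x < length \<mu> \<and> g x < \<mu> ! f x) w) = \<mu>"
proof -
  define S where "S = (\<lambda>x. f x < length \<mu> \<and> g x < \<mu> ! f x)"
  define \<rho> where "\<rho> = filter S w"
  define D where "D = Sigma {..<length \<mu>} (\<lambda>i. {..<\<mu> ! i})"
  have dist\<rho>: "distinct \<rho>" using dist by (simp add: \<rho>_def)
  have S: "f x < a \<and> g x < b" if "S x" for x
    using that \<mu>(2) \<mu>(3)[rule_format, of "f x"] by (auto simp: S_def)
  have inj: "inj_on (\<lambda>x. (f x, g x)) (set \<rho>)"
    using bij S unfolding bij_betw_def by (elim conjE inj_on_subset) (auto simp: \<rho>_def)
  have img: "(\<lambda>x. (f x, g x)) ` set \<rho> = D"
  proof
    show "(\<lambda>x. (f x, g x)) ` set \<rho> \<subseteq> D" by (auto simp: \<rho>_def S_def D_def)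
    show "D \<subseteq> (\<lambda>x. (f x, g x)) ` set \<rho>"
    proof
      fix p assume p: "p \<in> D"
      obtain i j where ij: "p = (i, j)" "i < length \<mu>" "j < \<mu> ! i" using p by (auto simp: D_def)
      have "p \<in> {..<a} \<times> {..<b}" using ij \<mu>(2) \<mu>(3)[rule_format, of i] by auto
      then obtain x where x: "x \<in> set w" "p = (f x, g x)" using bij unfolding bij_betw_def by blast
      then show "p \<in> (\<lambda>x. (f x, g x)) ` set \<rho>" using ij by (auto simp: \<rho>_def S_def)
    qed
  qed
  have len: "length (filter (\<lambda>x. Q (f x) (g x)) \<rho>) = card {(i, j) \<in> D. Q i j}" for Q
  proof -
    have "length (filter (\<lambda>x. Q (f x) (g x)) \<rho>) = card {x \<in> set \<rho>. Q (f x) (g x)}"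
      using dist\<rho> by (metis distinct_card distinct_filter set_filter)
    also have "\<dots> = card ((\<lambda>x. (f x, g x)) ` {x \<in> set \<rho>. Q (f x) (g x)})"
      by (rule card_image[symmetric], rule inj_on_subset[OF inj]) auto
    also have "(\<lambda>x. (f x, g x)) ` {x \<in> set \<rho>. Q (f x) (g x)} = {(i, j) \<in> D. Q i j}"
      unfolding img[symmetric] by auto
    finally show ?thesis .
  qed
  have "length \<rho> = card D" using len[of "\<lambda>_ _. True"] by simp
  then have sum: "length \<rho> = sum_list \<mu>" by (simp add: D_def sum_list_sum_nth atLeast0LessThan)
  have rows: "inc_cover r (sum_list (take r \<mu>)) \<rho>" for r
    unfolding inc_cover_def
  proof (intro exI conjI allI impI)
    fix c
    have "filter (\<lambda>x. f x = c) \<rho> = filter S (filter (\<lambda>x. f x = c) w)"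
      by (simp add: \<rho>_def conj_commute)
    \<comment> \<open>\<open>r\<close> may exceed \<open>a\<close>, where the classes of
      \<open>f\<close> need not be increasing; no selected entry has such a colour.\<close>
    moreover have "filter S (filter (\<lambda>x. f x = c) w) = []" if "\<not> c < a"
      using that S by (auto simp: filter_empty_conv)
    ultimately show "sorted (filter (\<lambda>x. f x = c) \<rho>)"
      using f[of c] by (cases "c < a") (auto simp del: filter_filter intro: sorted_wrt_filter)
    have "{(i, j) \<in> D. i < r} = Sigma {..<min r (length \<mu>)} (\<lambda>i. {..<\<mu> ! i})"
      by (auto simp: D_def)
    then show "sum_list (take r \<mu>) \<le> length (filter (\<lambda>x. f x < r) \<rho>)"
      by (simp add: len[of "\<lambda>i j. i < r"] sum_list_sum_nth atLeast0LessThan min.commute)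
  qed
  have cols: "inc_cover c (sum_list (map (\<lambda>l. min l c) \<mu>)) (rev \<rho>)" for c
    unfolding inc_cover_def
  proof (intro exI conjI allI impI)
    fix d
    have "filter (\<lambda>x. g x = d) (rev \<rho>) = filter S (filter (\<lambda>x. g x = d) (rev w))"
      by (simp add: \<rho>_def conj_commute rev_filter)
    moreover have "filter S (filter (\<lambda>x. g x = d) (rev w)) = []" if "\<not> d < b"
      using that S by (auto simp: filter_empty_conv)
    ultimately show "sorted (filter (\<lambda>x. g x = d) (rev \<rho>))"
      using g[of d] by (cases "d < b") (auto simp del: filter_filter intro: sorted_wrt_filter)
    have "{(i, j) \<in> D. j < c} = Sigma {..<length \<mu>} (\<lambda>i. {..<min (\<mu> ! i) c})"
      by (auto simp: D_def)
    then show "sum_list (map (\<lambda>l. min l c) \<mu>) \<le> length (filter (\<lambda>x. g x < c) (rev \<rho>))"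
      by (simp add: len[of "\<lambda>i j. j < c"] sum_list_sum_nth atLeast0LessThan flip: rev_filter)
  qed
  have "rs_shape \<rho> = \<mu>"
  proof (rule partition_eqI)
    show "is_partition (rs_shape \<rho>)" "is_partition \<mu>" "sum_list (rs_shape \<rho>) = sum_list \<mu>"
      using rs_shape_greene(1,2)[OF dist\<rho>] \<mu> sum by auto
    show "sum_list (take r \<mu>) \<le> sum_list (take r (rs_shape \<rho>))" for r
      using rs_shape_greene(5)[OF dist\<rho> rows] .
    show "sum_list (map (\<lambda>x. min x c) \<mu>) \<le> sum_list (map (\<lambda>x. min x c) (rs_shape \<rho>))" for c
      using rs_shape_greene(6)[OF dist\<rho> cols] .
  qed
  then show ?thesis unfolding \<rho>_def S_def .
qed

section \<open>Standardisation and pattern containment\<close>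

lemma row_insert_map:
  fixes h :: "'a::linorder \<Rightarrow> 'b::linorder"
  assumes h: "strict_mono_on A h" and "x \<in> A" "\<Union> (set ` set T) \<subseteq> A"
  shows "row_insert (h x) (map (map h) T) = map (map h) (row_insert x T)"
proof -
  have less: "h x < h y \<longleftrightarrow> x < y" if "x \<in> A" "y \<in> A" for x y
    using h that by (meson strict_mono_on_less)
  have bump: "bump (h x) (map h r) = map_prod (map h) (map_option h) (bump x r)"
    if "x \<in> A" "set r \<subseteq> A" for x r
    using that by (induction r) (auto simp: less split: prod.splits)
  have bump_set: "set_option (snd (bump x r)) \<subseteq> set r" for x :: 'a and r
    by (induction r) (auto split: prod.splits)
  show ?thesis using assms(2,3)
  proof (induction T arbitrary: x)
    case Nil
    then show ?case by simp
  next
    case (Cons r T)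
    obtain r' y where r: "bump x r = (r', y)" by fastforce
    then have "set_option y \<subseteq> A" using bump_set[of x r] Cons.prems by auto
    then show ?case
      using bump[of x r] Cons r by (cases y) auto
  qed
qed

lemma set_row_insert:
  fixes x :: "'a::linorder"
  shows "\<Union> (set ` set (row_insert x T)) = insert x (\<Union> (set ` set T))"
  using arg_cong[OF mset_row_insert[of x T], of set_mset] by simp

text \<open>Row insertion only compares letters, so the shape depends on their relative order
  alone.\<close>

lemma rs_shape_map:
  fixes h :: "'a::linorder \<Rightarrow> 'b::linorder"
  assumes h: "strict_mono_on (set w) h"
  shows "rs_shape (map h w) = rs_shape w"
proof -
  have "set v \<subseteq> set w \<Longrightarrow> insertion_tableau (map h v) = map (map h) (insertion_tableau v) \<and>
    \<Union> (set ` set (insertion_tableau v)) = set v" for v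
  proof (induction v rule: rev_induct)
    case Nil
    then show ?case by (simp add: insertion_tableau_def)
  next
    case (snoc x v)
    have "insertion_tableau (v @ [x]) = row_insert x (insertion_tableau v)"
      and "insertion_tableau (map h (v @ [x])) = row_insert (h x) (insertion_tableau (map h v))"
      by (simp_all add: insertion_tableau_def)
    then show ?case
      using snoc row_insert_map[OF h, of x "insertion_tableau v"] by (simp add: set_row_insert)
  qed
  then show ?thesis by (simp add: rs_shape_def comp_def)
qed

lemma subseq_nth:
  assumes "subseq \<rho> \<pi>"
  obtains i where "strict_mono_on {..<length \<rho>} i"
    and "\<And>j. j < length \<rho> \<Longrightarrow> i j < length \<pi> \<and> \<pi> ! i j = \<rho> ! j"
proof -
  have "\<exists>i. strict_mono_on {..<length \<rho>} i \<and> (\<forall>j<length \<rho>. i j < length \<pi> \<and> \<pi> ! i j = \<rho> ! j)"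
    using assms
  proof (induction rule: list_emb.induct)
    case (list_emb_Nil ys)
    then show ?case by (auto simp: strict_mono_on_def)
  next
    case (list_emb_Cons xs ys y)
    then obtain i where "strict_mono_on {..<length xs} i"
      "\<forall>j<length xs. i j < length ys \<and> ys ! i j = xs ! j" by auto
    then show ?case
      by (intro exI[of _ "\<lambda>j. Suc (i j)"]) (auto simp: strict_mono_on_def)
  next
    case (list_emb_Cons2 x y xs ys)
    then obtain i where "strict_mono_on {..<length xs} i"
      "\<forall>j<length xs. i j < length ys \<and> ys ! i j = xs ! j" by auto
    then show ?case using list_emb_Cons2
      by (intro exI[of _ "\<lambda>j. case j of 0 \<Rightarrow> 0 | Suc j \<Rightarrow> Suc (i j)"])
        (auto simp: strict_mono_on_def nth_Cons split: nat.splits)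
  qed
  then show thesis using that by blast
qed

text \<open>The standardisation of \<rho> is a permutation of the same shape and occurs in \<pi> as
  a pattern.\<close>

lemma not_shape_avoiding:
  assumes "subseq \<rho> \<pi>" "distinct \<rho>"
  shows "\<not> shape_avoiding (rs_shape \<rho>) \<pi>"
proof -
  \<comment> \<open>The rank of an entry, counted from 1 because the entry itself is
    included.\<close>
  define h where "h x = card {y \<in> set \<rho>. y \<le> x}" for x
  have mono: "strict_mono_on (set \<rho>) h"
    unfolding strict_mono_on_def h_def
  proof (intro allI impI psubset_card_mono)
    fix r s assume rs: "r \<in> set \<rho> \<and> s \<in> set \<rho> \<and> r < s"
    then have "s \<in> {y \<in> set \<rho>. y \<le> s} - {y \<in> set \<rho>. y \<le> r}" by simp
    moreover have "{y \<in> set \<rho>. y \<le> r} \<subseteq> {y \<in> set \<rho>. y \<le> s}" using rs by auto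
    ultimately show "{y \<in> set \<rho>. y \<le> r} \<subset> {y \<in> set \<rho>. y \<le> s}" by blast
  qed simp
  define \<sigma> where "\<sigma> = map h \<rho>"
  have dist: "distinct \<sigma>"
    using mono assms(2) by (simp add: \<sigma>_def distinct_map strict_mono_on_imp_inj_on)
  have "set \<sigma> \<subseteq> {1..length \<rho>}"
  proof
    fix z assume "z \<in> set \<sigma>"
    then obtain x where x: "x \<in> set \<rho>" "z = h x" by (auto simp: \<sigma>_def)
    have "h x \<noteq> 0" using x by (auto simp: h_def)
    moreover have "h x \<le> card (set \<rho>)" unfolding h_def by (rule card_mono) auto
    ultimately show "z \<in> {1..length \<rho>}" using x card_length[of \<rho>] by simp
  qed
  moreover have "card (set \<sigma>) = length \<rho>" using distinct_card[OF dist] by (simp add: \<sigma>_def)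
  ultimately have "set \<sigma> = {1..length \<rho>}" by (intro card_subset_eq) auto
  then have "\<sigma> \<in> permutations_of_set {1..sum_list (rs_shape \<rho>)}"
    using dist rs_shape_greene(2)[OF assms(2)] by (simp add: permutations_of_set_def)
  moreover have "rs_shape \<sigma> = rs_shape \<rho>" unfolding \<sigma>_def by (rule rs_shape_map[OF mono])
  moreover have "\<not> avoids \<pi> \<sigma>"
  proof -
    obtain i where i: "strict_mono_on {..<length \<rho>} i"
      "\<And>j. j < length \<rho> \<Longrightarrow> i j < length \<pi> \<and> \<pi> ! i j = \<rho> ! j"
      using subseq_nth[OF assms(1)] by blast
    have "\<pi> ! i j > \<pi> ! i l \<longleftrightarrow> \<sigma> ! j > \<sigma> ! l" if "j < length \<sigma>" "l < length \<sigma>" for j l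
      using that i(2) strict_mono_on_less[OF mono] by (simp add: \<sigma>_def)
    then show ?thesis
      using i unfolding avoids_def by (auto simp: \<sigma>_def intro!: exI[of _ i])
  qed
  ultimately show ?thesis unfolding shape_avoiding_def by blast
qed

section \<open>Upper bound\<close>

text \<open>Avoidance excludes shapes that contain the bounding rectangle of \<mu>. For any other
  shape the boundary path has a point with at most \<open>ht \<mu>\<close> rows and at most
  \<open>wd \<mu>\<close> columns, and its two covers are the colour classes.\<close>

lemma avoiding_coloring:
  assumes \<mu>: "is_partition \<mu>" "\<mu> \<noteq> []" and dist: "distinct \<pi>" and av: "shape_avoiding \<mu> \<pi>"
  obtains h :: "nat \<Rightarrow> nat"
  where "\<And>x. x \<in> set \<pi> \<Longrightarrow> h x < ht \<mu> + wd \<mu>"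
    and "\<And>c. sorted (filter (\<lambda>x. h x = c) (if c < ht \<mu> then \<pi> else rev \<pi>))"
proof -
  define l where "l = rs_shape \<pi>"
  define k where "k = length \<mu>"
  define m where "m = hd \<mu>"
  have k: "k > 0" "ht \<mu> = k - 1" using \<mu>(2) by (auto simp: k_def ht_def)
  have m: "m > 0" "wd \<mu> = m - 1" using \<mu> by (auto simp: m_def wd_def is_partition_def)
  have \<mu>_le: "\<forall>i<length \<mu>. \<mu> ! i \<le> m"
    using \<mu> by (cases \<mu>) (auto simp: is_partition_def m_def nth_Cons split: nat.split)
  have "is_partition l" unfolding l_def using rs_shape_greene(1)[OF dist] .
  then have anti: "l ! j \<le> l ! i" if "i \<le> j" "j < length l" for i j
    using that unfolding is_partition_def by (cases "i = j") (auto simp: sorted_wrt_iff_nth_less)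
  have not_corner: "\<not> (k \<le> length l \<and> m \<le> l ! (k - 1))"
  proof
    assume corner: "k \<le> length l \<and> m \<le> l ! (k - 1)"
    \<comment> \<open>The rows of length at least \<open>m\<close> form an initial segment, so
      \<open>(a, m)\<close> lies on the boundary path, and \<open>k \<le> a\<close> leaves room for
      all rows of \<mu>.\<close>
    define a where "a = card {i. i < length l \<and> m \<le> l ! i}"
    have "{i. i < length l \<and> m \<le> l ! i} = {..<a}"
    proof -
      have "\<exists>a. {i. i < length l \<and> m \<le> l ! i} = {..<a}"
      proof (cases "\<exists>i<length l. l ! i < m")
        case False
        then have "{i. i < length l \<and> m \<le> l ! i} = {..<length l}" by auto
        then show ?thesis by blast
      next
        case True
        define q where "q = (LEAST i. i < length l \<and> l ! i < m)"
        have q: "q < length l" "l ! q < m" using LeastI_ex[OF True] by (auto simp: q_def)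
        have "m \<le> l ! i" if "i < q" for i
          using not_less_Least[of i "\<lambda>i. i < length l \<and> l ! i < m"] that q(1) by (auto simp: q_def)
        moreover have "i < q" if "i < length l" "m \<le> l ! i" for i
          using anti[of q i] that q by (cases "i < q") auto
        moreover have "i < length l" if "i < q" for i using that q(1) by simp
        ultimately have "{i. i < length l \<and> m \<le> l ! i} = {..<q}" by blast
        then show ?thesis by blast
      qed
      then obtain q where q: "{i. i < length l \<and> m \<le> l ! i} = {..<q}" by blast
      then have "a = q" by (simp only: a_def card_lessThan)
      then show ?thesis using q by simp
    qed
    then have a: "i < length l \<and> m \<le> l ! i \<longleftrightarrow> i < a" for i by blast
    have al: "a \<le> length l" using a[of "length l"] by simp
    have al': "a \<le> length (rs_shape \<pi>)" using al by (simp add: l_def)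
    have ge: "\<forall>i<a. m \<le> rs_shape \<pi> ! i" using a unfolding l_def by blast
    have le: "\<forall>i<length (rs_shape \<pi>). a \<le> i \<longrightarrow> rs_shape \<pi> ! i \<le> m"
      using a unfolding l_def by (metis leD nat_le_linear)
    have "k - 1 < a" using corner k a[of "k - 1"] by auto
    obtain f g :: "nat \<Rightarrow> nat"
      where "\<And>c. c < a \<Longrightarrow> sorted (filter (\<lambda>x. f x = c) \<pi>)"
      and "\<And>d. d < m \<Longrightarrow> sorted (filter (\<lambda>x. g x = d) (rev \<pi>))"
      and "\<And>x. x \<in> set \<pi> \<Longrightarrow> f x < a \<or> g x < m"
      and "bij_betw (\<lambda>x. (f x, g x)) {x \<in> set \<pi>. f x < a \<and> g x < m} ({..<a} \<times> {..<m})"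
      using greene_split[OF dist al' ge le] by blast
    then have "rs_shape (filter (\<lambda>x. f x < length \<mu> \<and> g x < \<mu> ! f x) \<pi>) = \<mu>"
      using dist \<mu>(1) \<mu>_le \<open>k - 1 < a\<close> by (intro grid_pattern[of \<pi> \<mu> a m f g]) (auto simp: k_def)
    moreover have "\<not> shape_avoiding (rs_shape (filter (\<lambda>x. f x < length \<mu> \<and> g x < \<mu> ! f x) \<pi>)) \<pi>"
      by (rule not_shape_avoiding) (use dist in auto)
    ultimately show False using av by simp
  qed
  \<comment> \<open>A boundary point above row \<open>k\<close>: \<open>b\<close> is the length of
    that row, or 0 if it does not exist, and \<open>not_corner\<close> makes it smaller than
    \<open>m\<close>.\<close>
  define a where "a = min (k - 1) (length l)"
  define b where "b = (if k \<le> length l then l ! (k - 1) else 0)"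
  have b: "b < m" using not_corner m by (auto simp: b_def)
  have ge: "\<forall>i<a. b \<le> rs_shape \<pi> ! i"
    using anti[of _ "k - 1"] k by (auto simp: a_def b_def l_def)
  have le: "\<forall>i<length (rs_shape \<pi>). a \<le> i \<longrightarrow> rs_shape \<pi> ! i \<le> b"
    using anti[of "k - 1"] by (auto simp: a_def b_def l_def)
  have al: "a \<le> length (rs_shape \<pi>)" by (simp add: a_def l_def)
  obtain f g :: "nat \<Rightarrow> nat"
    where f: "\<And>c. c < a \<Longrightarrow> sorted (filter (\<lambda>x. f x = c) \<pi>)"
    and g: "\<And>d. d < b \<Longrightarrow> sorted (filter (\<lambda>x. g x = d) (rev \<pi>))"
    and fg: "\<And>x. x \<in> set \<pi> \<Longrightarrow> f x < a \<or> g x < b"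
    and "bij_betw (\<lambda>x. (f x, g x)) {x \<in> set \<pi>. f x < a \<and> g x < b} ({..<a} \<times> {..<b})"
    using greene_split[OF dist al ge le] by blast
  \<comment> \<open>Decreasing colours start at \<open>ht \<mu>\<close> instead of \<open>a\<close>,
    so that the direction of a class depends on its colour alone and not on the permutation.\<close>
  define h where "h x = (if f x < a then f x else ht \<mu> + g x)" for x
  have ak: "a \<le> ht \<mu>" using k by (simp add: a_def)
  show thesis
  proof
    show "h x < ht \<mu> + wd \<mu>" if "x \<in> set \<pi>" for x
      using fg[OF that] ak b m by (auto simp: h_def)
    show "sorted (filter (\<lambda>x. h x = c) (if c < ht \<mu> then \<pi> else rev \<pi>))" for c
    proof (cases "c < ht \<mu>")
      case True
      then have "filter (\<lambda>x. h x = c) \<pi> = (if c < a then filter (\<lambda>x. f x = c) \<pi> else [])"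
        using ak by (auto simp: h_def filter_empty_conv intro!: filter_cong)
      then show ?thesis using f True by simp
    next
      case False
      then have "filter (\<lambda>x. h x = c) (rev \<pi>) =
          filter (\<lambda>x. \<not> f x < a) (filter (\<lambda>x. g x = c - ht \<mu>) (rev \<pi>))"
        using ak by (auto simp: h_def intro!: filter_cong)
      moreover have "sorted (filter (\<lambda>x. \<not> f x < a) (filter (\<lambda>x. g x = c - ht \<mu>) (rev \<pi>)))"
      proof (cases "c - ht \<mu> < b")
        case True
        then show ?thesis by (intro sorted_wrt_filter g)
      next
        case False
        then have "filter (\<lambda>x. \<not> f x < a) (filter (\<lambda>x. g x = c - ht \<mu>) (rev \<pi>)) = []"
          using fg by (fastforce simp: filter_empty_conv)
        then show ?thesis by simp
      qed
      ultimately show ?thesis using False by simp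
    qed
  qed
qed

text \<open>The colour word tells from which class the next entry is taken.\<close>

lemma list_eq_by_classes:
  assumes "map h xs = map h ys" "\<And>c. filter (\<lambda>x. h x = c) xs = filter (\<lambda>x. h x = c) ys"
  shows "xs = ys"
  using assms
proof (induction xs arbitrary: ys)
  case Nil
  then show ?case by simp
next
  case (Cons x xs)
  then obtain y zs where ys: "ys = y # zs" by (cases ys) auto
  have hxy: "h x = h y" using Cons.prems(1) ys by simp
  then have "x = y" using Cons.prems(2)[of "h x"] ys by simp
  moreover have "xs = zs"
  proof (rule Cons.IH)
    show "map h xs = map h zs" using Cons.prems(1) ys by simp
    show "filter (\<lambda>x. h x = c) xs = filter (\<lambda>x. h x = c) zs" for c
      using Cons.prems(2)[of c] ys \<open>x = y\<close> by (cases "h y = c") auto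
  qed
  ultimately show ?case using ys by simp
qed

text \<open>The colours of the values give each class as a set, the colour itself gives the
  direction of the class, and the colours of the positions give the interleaving. So two words over
  \<open>ht \<mu> + wd \<mu>\<close> letters determine the permutation.\<close>

lemma avoid_count_le:
  assumes \<mu>: "is_partition \<mu>" "\<mu> \<noteq> []"
  shows "avoid_count \<mu> n \<le> (ht \<mu> + wd \<mu>) ^ (2 * n)"
proof -
  let ?K = "ht \<mu> + wd \<mu>"
  let ?A = "{\<pi> \<in> permutations_of_set {1..n}. shape_avoiding \<mu> \<pi>}"
  define good where "good \<pi> h \<longleftrightarrow> (\<forall>x\<in>set \<pi>. h x < ?K) \<and>
    (\<forall>c. sorted (filter (\<lambda>x. h x = c) (if c < ht \<mu> then \<pi> else rev \<pi>)))"
    for \<pi> :: "nat list" and h :: "nat \<Rightarrow> nat"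
  have "\<exists>h. good \<pi> h" if "\<pi> \<in> ?A" for \<pi>
  proof -
    have "distinct \<pi>" "shape_avoiding \<mu> \<pi>" using that by (auto simp: permutations_of_set_def)
    then show ?thesis using avoiding_coloring[OF \<mu>] unfolding good_def by metis
  qed
  then obtain H where H: "\<And>\<pi>. \<pi> \<in> ?A \<Longrightarrow> good \<pi> (H \<pi>)" by metis
  define code where "code \<pi> = (map (H \<pi>) \<pi>, map (H \<pi>) [1..<Suc n])" for \<pi>
  define W where "W = {u. set u \<subseteq> {..<?K} \<and> length u = n}"
  have "code ` ?A \<subseteq> W \<times> W"
  proof
    fix z assume "z \<in> code ` ?A"
    then obtain \<pi> where \<pi>: "\<pi> \<in> ?A" "z = code \<pi>" by blast
    have "set \<pi> = {1..n}" "distinct \<pi>" using \<pi>(1) by (auto simp: permutations_of_set_def)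
    moreover from this have "length \<pi> = n" using distinct_card by fastforce
    ultimately show "z \<in> W \<times> W" using H[OF \<pi>(1)] unfolding \<pi>(2) code_def W_def good_def by auto
  qed
  moreover have "inj_on code ?A"
  proof (rule inj_onI)
    fix \<pi> \<rho> assume A: "\<pi> \<in> ?A" "\<rho> \<in> ?A" and eq: "code \<pi> = code \<rho>"
    let ?h = "H \<pi>"
    have sets: "set \<pi> = {1..n}" "set \<rho> = {1..n}" and dist: "distinct \<pi>" "distinct \<rho>"
      using A by (auto simp: permutations_of_set_def)
    have Heq: "H \<rho> x = ?h x" if "x \<in> {1..n}" for x
    proof -
      have "map (H \<pi>) [1..<Suc n] = map (H \<rho>) [1..<Suc n]" using eq by (simp only: code_def prod.inject)
      then have "\<forall>x\<in>set [1..<Suc n]. H \<pi> x = H \<rho> x" by (simp only: map_eq_conv)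
      then show ?thesis using that unfolding set_upt by fastforce
    qed
    show "\<pi> = \<rho>"
    proof (rule list_eq_by_classes[of ?h])
      have "map (H \<rho>) \<rho> = map ?h \<rho>" using Heq sets by simp
      then show "map ?h \<pi> = map ?h \<rho>" using eq by (simp add: code_def)
      fix c
      let ?p = "if c < ht \<mu> then \<pi> else rev \<pi>" and ?r = "if c < ht \<mu> then \<rho> else rev \<rho>"
      have "filter (\<lambda>x. H \<rho> x = c) ?r = filter (\<lambda>x. ?h x = c) ?r"
        using Heq sets by (intro filter_cong) (auto split: if_splits)
      then have "sorted (filter (\<lambda>x. ?h x = c) ?p)" "sorted (filter (\<lambda>x. ?h x = c) ?r)"
        using H[OF A(1)] H[OF A(2)] unfolding good_def by metis+
      moreover have "distinct (filter (\<lambda>x. ?h x = c) ?p)" "distinct (filter (\<lambda>x. ?h x = c) ?r)"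
        using dist by auto
      moreover have "set (filter (\<lambda>x. ?h x = c) ?p) = set (filter (\<lambda>x. ?h x = c) ?r)"
        using sets by auto
      ultimately have "filter (\<lambda>x. ?h x = c) ?p = filter (\<lambda>x. ?h x = c) ?r"
        by (intro sorted_distinct_set_unique)
      then show "filter (\<lambda>x. ?h x = c) \<pi> = filter (\<lambda>x. ?h x = c) \<rho>"
        by (simp flip: rev_filter split: if_splits)
    qed
  qed
  moreover have "finite W" unfolding W_def by (rule finite_lists_length_eq) simp
  ultimately have "card ?A \<le> card (W \<times> W)"
    by (intro card_inj_on_le[of code]) auto
  also have "\<dots> = ?K ^ (2 * n)"
    unfolding W_def card_cartesian_product card_lists_length_eq[OF finite_lessThan]
    by (simp add: mult_2 power_add)
  finally show ?thesis unfolding avoid_count_def .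
qed

section \<open>Lower bound\<close>

definition merges :: "nat \<Rightarrow> nat \<Rightarrow> nat list set" where
  "merges a n = {\<pi> \<in> permutations_of_set {1..n}.
     \<exists>f. (\<forall>x\<in>set \<pi>. f x < a) \<and> (\<forall>c::nat. sorted (filter (\<lambda>x. f x = c) \<pi>))}"

lemma finite_merges: "finite (merges a n)"
  by (simp add: merges_def)

text \<open>Of more than \<open>a\<close> entries of \<sigma> that run against \<open>R\<close>, two
  would be matched with entries of \<pi> of one colour, which run along \<open>R\<close>. The
  parameter \<open>R\<close> treats both directions at once.\<close>

lemma avoids_monotone:
  fixes R :: "nat \<Rightarrow> nat \<Rightarrow> bool" and f :: "nat \<Rightarrow> nat"
  assumes R: "R = (\<le>) \<or> R = (\<ge>)" and dist: "distinct \<pi>" "distinct \<sigma>"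
    and f: "\<forall>x\<in>set \<pi>. f x < a"
    and col: "\<And>i j. i < j \<Longrightarrow> j < length \<pi> \<Longrightarrow> f (\<pi> ! i) = f (\<pi> ! j) \<Longrightarrow> R (\<pi> ! i) (\<pi> ! j)"
    and J: "J \<subseteq> {..<length \<sigma>}" "a < card J"
    and anti: "\<And>j l. j \<in> J \<Longrightarrow> l \<in> J \<Longrightarrow> j < l \<Longrightarrow> R (\<sigma> ! l) (\<sigma> ! j)"
  shows "avoids \<pi> \<sigma>"
  unfolding avoids_def
proof
  assume "\<exists>i. strict_mono_on {..<length \<sigma>} i \<and> i ` {..<length \<sigma>} \<subseteq> {..<length \<pi>} \<and>
    (\<forall>j<length \<sigma>. \<forall>l<length \<sigma>. (\<pi> ! i l < \<pi> ! i j) = (\<sigma> ! l < \<sigma> ! j))"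
  then obtain i where i: "strict_mono_on {..<length \<sigma>} i" "i ` {..<length \<sigma>} \<subseteq> {..<length \<pi>}"
    and ord: "\<And>j l. j < length \<sigma> \<Longrightarrow> l < length \<sigma> \<Longrightarrow> (\<pi> ! i l < \<pi> ! i j) = (\<sigma> ! l < \<sigma> ! j)"
    by blast
  let ?h = "\<lambda>j. f (\<pi> ! i j)"
  have "\<not> inj_on ?h J"
  proof
    assume "inj_on ?h J"
    moreover have "?h ` J \<subseteq> {..<a}" using f i(2) J(1) by (auto simp: subset_iff)
    ultimately have "card J \<le> card {..<a}" by (intro card_inj_on_le) auto
    then show False using J(2) by simp
  qed
  then obtain j l where jl: "j \<in> J" "l \<in> J" "?h j = ?h l" "j < l"
    unfolding inj_on_def by (metis linorder_neqE_nat)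
  then have len: "j < length \<sigma>" "l < length \<sigma>" using J(1) by auto
  then have ij: "i j < i l" "i l < length \<pi>"
    using i jl(4) by (auto simp: strict_mono_on_def)
  have "R (\<pi> ! i j) (\<pi> ! i l)" using col[OF ij jl(3)] .
  moreover have "\<pi> ! i j \<noteq> \<pi> ! i l" using ij dist(1) by (simp add: nth_eq_iff_index_eq)
  moreover have "R (\<sigma> ! l) (\<sigma> ! j)" using anti jl by blast
  moreover have "\<sigma> ! j \<noteq> \<sigma> ! l" using len jl(4) dist(2) by (simp add: nth_eq_iff_index_eq)
  ultimately show False using R ord[OF len] ord[OF len(2,1)] by auto
qed

lemma sorted_filter_iff:
  fixes w :: "'a::linorder list"
  shows "sorted (filter P w) \<longleftrightarrow>
    (\<forall>i j. i < j \<longrightarrow> j < length w \<longrightarrow> P (w ! i) \<longrightarrow> P (w ! j) \<longrightarrow> w ! i \<le> w ! j)"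
proof (induction w)
  case Nil
  then show ?case by simp
next
  case (Cons x w)
  have "(\<forall>i j. i < j \<longrightarrow> j < length (x # w) \<longrightarrow> P ((x # w) ! i) \<longrightarrow> P ((x # w) ! j) \<longrightarrow>
      (x # w) ! i \<le> (x # w) ! j) \<longleftrightarrow>
    (\<forall>j<length w. P x \<longrightarrow> P (w ! j) \<longrightarrow> x \<le> w ! j) \<and>
    (\<forall>i j. i < j \<longrightarrow> j < length w \<longrightarrow> P (w ! i) \<longrightarrow> P (w ! j) \<longrightarrow> w ! i \<le> w ! j)"
    (is "?L \<longleftrightarrow> ?R1 \<and> ?R2")
  proof (intro iffI conjI)
    assume L: ?L
    show ?R1
      using L[rule_format, of 0 "Suc _"] by auto
    show ?R2
      using L[rule_format, of "Suc _" "Suc _"] by auto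
  next
    assume R: "?R1 \<and> ?R2"
    show ?L
    proof (intro allI impI)
      fix i j assume *: "i < j" "j < length (x # w)" "P ((x # w) ! i)" "P ((x # w) ! j)"
      then obtain j' where j: "j = Suc j'" by (cases j) auto
      show "(x # w) ! i \<le> (x # w) ! j"
        using * R j by (cases i) auto
    qed
  qed
  then show ?case
    using Cons.IH by (auto simp: all_set_conv_all_nth in_set_conv_nth)
qed

lemma sorted_filter_revD:
  fixes w :: "'a::linorder list"
  assumes "sorted (filter P (rev w))" "i < j" "j < length w" "P (w ! i)" "P (w ! j)"
  shows "w ! j \<le> w ! i"
proof -
  have "length w - Suc j < length w - Suc i" "length w - Suc i < length (rev w)"
    and "rev w ! (length w - Suc j) = w ! j" "rev w ! (length w - Suc i) = w ! i"
    using assms(2,3) by (simp_all add: rev_nth)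
  then show ?thesis
    using assms(1,4,5) unfolding sorted_filter_iff by metis
qed

text \<open>Greene's theorem for one column or one row gives a pattern of shape \<mu> a decreasing
  or an increasing subsequence with one entry more than there are classes. Reversal makes the
  classes decreasing for the second claim.\<close>

lemma merges_shape_avoiding:
  assumes \<pi>: "\<pi> \<in> merges a n" and \<mu>: "is_partition \<mu>" "\<mu> \<noteq> []"
  shows "a = ht \<mu> \<Longrightarrow> shape_avoiding \<mu> \<pi>" and "a = wd \<mu> \<Longrightarrow> shape_avoiding \<mu> (rev \<pi>)"
proof -
  obtain f :: "nat \<Rightarrow> nat" where f: "\<forall>x\<in>set \<pi>. f x < a" "\<And>c. sorted (filter (\<lambda>x. f x = c) \<pi>)"
    and dist: "distinct \<pi>"
    using \<pi> by (auto simp: merges_def permutations_of_set_def)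
  {
    assume a: "a = ht \<mu>"
    show "shape_avoiding \<mu> \<pi>"
      unfolding shape_avoiding_def
    proof (intro ballI impI)
      fix \<sigma> assume "\<sigma> \<in> permutations_of_set {1..sum_list \<mu>}" and shape: "rs_shape \<sigma> = \<mu>"
      then have d\<sigma>: "distinct \<sigma>" by (simp add: permutations_of_set_def)
      obtain g :: "nat \<Rightarrow> nat" where g: "sorted (filter (\<lambda>x. g x = 0) (rev \<sigma>))"
        and N: "sum_list (map (\<lambda>l. min l 1) \<mu>) \<le> length (filter (\<lambda>x. g x < 1) (rev \<sigma>))"
        using rs_shape_greene(4)[OF d\<sigma>, of 1] unfolding inc_cover_def shape by auto
      \<comment> \<open>All parts are positive, so the first column has \<open>length \<mu>\<close>
        cells.\<close>
      have "map (\<lambda>l. min l 1) \<mu> = map (\<lambda>l. 1) \<mu>"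
        using \<mu>(1) by (intro map_cong) (auto simp: is_partition_def)
      then have "length \<mu> \<le> length (filter (\<lambda>x. g x = 0) \<sigma>)"
        using N by (simp add: sum_list_triv del: map_eq_conv flip: rev_filter)
      then have "a < card {j. j < length \<sigma> \<and> g (\<sigma> ! j) = 0}"
        using a \<mu>(2) by (cases \<mu>) (simp_all add: length_filter_conv_card ht_def)
      then show "avoids \<pi> \<sigma>"
        using f(2) g unfolding sorted_filter_iff[of _ \<pi>]
        by (intro avoids_monotone[OF _ dist d\<sigma> f(1), where R = "(\<le>)"])
          (auto intro: sorted_filter_revD[OF g])
    qed
  next
    assume a: "a = wd \<mu>"
    show "shape_avoiding \<mu> (rev \<pi>)"
      unfolding shape_avoiding_def
    proof (intro ballI impI)
      fix \<sigma> assume "\<sigma> \<in> permutations_of_set {1..sum_list \<mu>}" and shape: "rs_shape \<sigma> = \<mu>"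
      then have d\<sigma>: "distinct \<sigma>" by (simp add: permutations_of_set_def)
      obtain g :: "nat \<Rightarrow> nat" where g: "sorted (filter (\<lambda>x. g x = 0) \<sigma>)"
        and N: "sum_list (take 1 \<mu>) \<le> length (filter (\<lambda>x. g x < 1) \<sigma>)"
        using rs_shape_greene(3)[OF d\<sigma>, of 1] unfolding inc_cover_def shape by auto
      have "hd \<mu> \<le> length (filter (\<lambda>x. g x = 0) \<sigma>)" "hd \<mu> > 0"
        using N \<mu> by (cases \<mu>; simp add: is_partition_def)+
      then have "a < card {j. j < length \<sigma> \<and> g (\<sigma> ! j) = 0}"
        using a by (simp add: length_filter_conv_card wd_def)
      moreover have "rev \<pi> ! j \<le> rev \<pi> ! i"
        if "i < j" "j < length (rev \<pi>)" "f (rev \<pi> ! i) = f (rev \<pi> ! j)" for i j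
        using that f(2)[of "f (rev \<pi> ! j)"] by (intro sorted_filter_revD[where P = "\<lambda>x. f x = f (rev \<pi> ! j)"]) auto
      ultimately show "avoids (rev \<pi>) \<sigma>"
        using f(1) g dist d\<sigma> unfolding sorted_filter_iff[of _ \<sigma>]
        by (intro avoids_monotone[where R = "(\<ge>)" and f = f and a = a and J = "{j. j < length \<sigma> \<and> g (\<sigma> ! j) = 0}"]) auto
    qed
  }
qed

lemma card_merges_le_avoid_count:
  assumes \<mu>: "is_partition \<mu>" "\<mu> \<noteq> []" and a: "a = ht \<mu> \<or> a = wd \<mu>"
  shows "card (merges a n) \<le> avoid_count \<mu> n"
proof -
  let ?A = "{\<pi> \<in> permutations_of_set {1..n}. shape_avoiding \<mu> \<pi>}"
  have fin: "finite ?A" by simp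
  show ?thesis
    using a
  proof
    assume "a = ht \<mu>"
    then have "merges a n \<subseteq> ?A" using merges_shape_avoiding(1)[OF _ \<mu>] by (auto simp: merges_def)
    then show ?thesis unfolding avoid_count_def using fin by (rule card_mono[rotated])
  next
    assume "a = wd \<mu>"
    then have "rev ` merges a n \<subseteq> ?A"
      using merges_shape_avoiding(2)[OF _ \<mu>] by (auto simp: merges_def permutations_of_set_def)
    then have "card (rev ` merges a n) \<le> card ?A" using fin by (rule card_mono[rotated])
    moreover have "card (rev ` merges a n) = card (merges a n)" by (simp add: card_image inj_on_def)
    ultimately show ?thesis unfolding avoid_count_def by simp
  qed
qed

text \<open>A new maximum at the end fits into any class; colour 0 exists because \<open>a\<close>
  is positive.\<close>

lemma card_merges_mono:
  assumes "0 < a" "m \<le> n"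
  shows "card (merges a m) \<le> card (merges a n)"
  using assms(2)
proof (induction rule: dec_induct)
  case base
  then show ?case by simp
next
  case (step n)
  have "(\<lambda>\<pi>. \<pi> @ [Suc n]) ` merges a n \<subseteq> merges a (Suc n)"
  proof
    fix \<rho> assume "\<rho> \<in> (\<lambda>\<pi>. \<pi> @ [Suc n]) ` merges a n"
    then obtain \<pi> f where \<rho>: "\<rho> = \<pi> @ [Suc n]" and s: "set \<pi> = {1..n}" "distinct \<pi>"
      and f: "\<forall>x\<in>set \<pi>. f x < a" "\<forall>c::nat. sorted (filter (\<lambda>x. f x = c) \<pi>)"
      by (auto simp: merges_def permutations_of_set_def)
    define g where "g x = (if x = Suc n then 0 else f x)" for x
    have "filter (\<lambda>x. g x = c) \<pi> = filter (\<lambda>x. f x = c) \<pi>" for c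
      using s by (intro filter_cong) (auto simp: g_def)
    then have "sorted (filter (\<lambda>x. g x = c) \<rho>)" for c
      using f(2) s by (auto simp: \<rho> sorted_append)
    moreover have "\<forall>x\<in>set \<rho>. g x < a" using f(1) assms(1) by (auto simp: \<rho> g_def)
    moreover have "\<rho> \<in> permutations_of_set {1..Suc n}"
      using s by (auto simp: \<rho> permutations_of_set_def)
    ultimately show "\<rho> \<in> merges a (Suc n)" unfolding merges_def by blast
  qed
  then have "card ((\<lambda>\<pi>. \<pi> @ [Suc n]) ` merges a n) \<le> card (merges a (Suc n))"
    using finite_merges by (rule card_mono[rotated])
  moreover have "card ((\<lambda>\<pi>. \<pi> @ [Suc n]) ` merges a n) = card (merges a n)"
    by (simp add: card_image inj_on_def)
  ultimately show ?case using step.IH by simp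
qed

section \<open>Permutations from pairs of words\<close>

lemma colored_arrangement:
  fixes xs :: "nat list"
  assumes "sorted xs" "distinct xs" "mset (map h xs) = mset u"
  shows "\<exists>\<pi>. mset \<pi> = mset xs \<and> map h \<pi> = u \<and> (\<forall>c. sorted (filter (\<lambda>x. h x = c) \<pi>))"
  using assms
proof (induction u arbitrary: xs)
  case Nil
  then show ?case by simp
next
  case (Cons c u)
  have "c \<in> set (map h xs)" using Cons.prems(3) by (metis list.set_intros(1) set_mset_mset)
  then have "\<exists>x\<in>set xs. h x = c" by auto
  \<comment> \<open>As \<open>xs\<close> is sorted, its first entry of the required colour is the
    smallest one, and it comes next.\<close>
  then obtain p x s where xs: "xs = p @ x # s" "h x = c" "\<forall>y\<in>set p. h y \<noteq> c"
    by (rule split_list_first_propE) auto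
  have "sorted (p @ s)" "distinct (p @ s)" "mset (map h (p @ s)) = mset u"
    using Cons.prems xs by (auto simp: sorted_append)
  then obtain \<pi> where \<pi>: "mset \<pi> = mset (p @ s)" "map h \<pi> = u" "\<forall>c. sorted (filter (\<lambda>x. h x = c) \<pi>)"
    using Cons.IH by blast
  have "x \<le> y" if "y \<in> set \<pi>" "h y = c" for y
  proof -
    have "y \<in> set (p @ s)" using \<pi>(1) that by (metis set_mset_mset)
    then show ?thesis using that xs Cons.prems(1) by (auto simp: sorted_append)
  qed
  then have "mset (x # \<pi>) = mset xs \<and> map h (x # \<pi>) = c # u \<and> (\<forall>c. sorted (filter (\<lambda>x. h x = c) (x # \<pi>)))"
    using \<pi> xs by auto
  then show ?case by (rule exI)
qed

text \<open>\<open>u\<close> colours the positions and \<open>v\<close> the values; \<pi> matches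
  the \<open>j\<close>-th occurrence of a letter in \<open>u\<close> with its \<open>j\<close>-th
  occurrence in \<open>v\<close>. The counting equation records this matching for the
  decoding.\<close>

lemma merge_of_words:
  assumes mset: "mset u = mset v" and a: "set u \<subseteq> {..<a}"
  obtains \<pi> where "\<pi> \<in> merges a (length v)" "map (\<lambda>x. v ! (x - 1)) \<pi> = u"
    and "\<And>p. p < length u \<Longrightarrow>
      count_list (take p u) (u ! p) = count_list (take (\<pi> ! p - 1) v) (u ! p)"
proof -
  define n where "n = length v"
  define h where "h x = v ! (x - 1)" for x
  have hv: "map h [1..<Suc n] = v" 
    by (rule nth_equalityI) (simp_all add: h_def n_def del: upt_Suc)
  obtain \<pi> where \<pi>: "mset \<pi> = mset [1..<Suc n]" "map h \<pi> = u" "\<forall>c. sorted (filter (\<lambda>x. h x = c) \<pi>)"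
    using colored_arrangement[OF sorted_upt distinct_upt, of h 1 "Suc n" u] hv mset by metis
  have s: "set \<pi> = {1..n}" using arg_cong[OF \<pi>(1), of set_mset] by auto
  have d: "distinct \<pi>" using \<pi>(1) by (metis distinct_upt mset_eq_imp_distinct_iff)
  have len: "length u = n" using mset by (metis n_def size_mset)
  have lp: "length \<pi> = n" using \<pi>(2) len by auto
  show thesis
  proof (rule that[of \<pi>])
    have "\<forall>x\<in>set \<pi>. h x < a" using a unfolding \<pi>(2)[symmetric] by auto
    then show "\<pi> \<in> merges a (length v)"
      using s d \<pi>(3) unfolding merges_def permutations_of_set_def n_def by blast
    show "map (\<lambda>x. v ! (x - 1)) \<pi> = u" using \<pi>(2) unfolding h_def .
    fix p assume p: "p < length u"
    define x where "x = \<pi> ! p"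
    define c where "c = u ! p"
    have hx: "h x = c" using arg_cong[OF \<pi>(2), of "\<lambda>l. l ! p"] p len lp by (simp add: x_def c_def)
    have "x \<in> set \<pi>" using p len lp by (simp add: x_def)
    then have x: "1 \<le> x" "x \<le> n" using s by auto
    let ?F = "filter (\<lambda>x. h x = c)"
    \<comment> \<open>Both sides list the values of colour \<open>c\<close> in increasing order.
      Cutting them at \<open>x\<close> identifies the entries before \<open>x\<close> in \<pi> with
      the values below \<open>x\<close>.\<close>
    have "?F \<pi> = ?F [1..<Suc n]"
    proof (rule sorted_distinct_set_unique)
      show "sorted (?F [1..<Suc n])" by (rule sorted_wrt_filter) (rule sorted_upt)
    qed (use \<pi>(3) d s in auto)
    moreover have "\<pi> = take p \<pi> @ x # drop (Suc p) \<pi>"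
      using p len lp by (simp add: x_def id_take_nth_drop)
    from arg_cong[OF this, of ?F] have "?F \<pi> = ?F (take p \<pi>) @ x # ?F (drop (Suc p) \<pi>)"
      using hx by simp
    moreover have "[1..<Suc n] = [1..<x] @ x # [Suc x..<Suc n]"
      using x upt_add_eq_append[of 1 x "Suc n - x"] by (simp add: upt_conv_Cons del: upt_Suc)
    from arg_cong[OF this, of ?F] have "?F [1..<Suc n] = ?F [1..<x] @ x # ?F [Suc x..<Suc n]"
      using hx by (simp del: upt_Suc)
    ultimately have "?F (take p \<pi>) @ x # ?F (drop (Suc p) \<pi>) = ?F [1..<x] @ x # ?F [Suc x..<Suc n]"
      by (simp only:)
    moreover have "x \<notin> set (?F (take p \<pi>))" "x \<notin> set (?F (drop (Suc p) \<pi>))"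
      using d p len lp by (auto simp: x_def in_set_conv_nth nth_eq_iff_index_eq)
    ultimately have "?F (take p \<pi>) = ?F [1..<x]"
      using append_Cons_eq_iff[of x "?F (take p \<pi>)" "?F (drop (Suc p) \<pi>)"] by blast
    then have "count_list (map h (take p \<pi>)) c = count_list (map h [1..<x]) c"
      by (simp add: count_list_eq_length_filter filter_map comp_def eq_commute)
    moreover have "map h (take p \<pi>) = take p u" using \<pi>(2) by (simp flip: take_map)
    moreover have "map h [1..<x] = take (x - 1) v"
      using x by (subst hv[symmetric]) (simp add: take_map take_upt del: upt_Suc)
    ultimately show "count_list (take p u) (u ! p) = count_list (take (\<pi> ! p - 1) v) (u ! p)"
      by (simp add: x_def c_def)
  qed
qed

section \<open>Words of fixed content on a diagonal band\<close>

definition words :: "nat \<Rightarrow> (nat \<Rightarrow> nat) \<Rightarrow> nat list set" where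
  "words a \<kappa> = {w. set w \<subseteq> {..<a} \<and> (\<forall>c<a. count_list w c = \<kappa> c)}"

lemma length_word: "set (w :: nat list) \<subseteq> {..<a} \<Longrightarrow> length w = (\<Sum>c<a. count_list w c)"
  using sum_count_set[of w "{..<a}"] by simp

text \<open>Pigeonhole: the \<open>a ^ N\<close> words of length \<open>N\<close> have at most
  \<open>(N + 1) ^ a\<close> different contents.\<close>

lemma exists_large_content:
  assumes "0 < a"
  obtains \<kappa> where "a ^ N \<le> card (words a \<kappa>) * (N + 1) ^ a" "(\<Sum>c<a. \<kappa> c) = N"
proof -
  let ?W = "{w. set w \<subseteq> {..<a} \<and> length w = N}"
  let ?B = "{\<kappa>. set \<kappa> \<subseteq> {..N} \<and> length \<kappa> = a}"
  let ?f = "\<lambda>w. map (count_list w) [0..<a]"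
  have fin: "finite ?W" "finite ?B" by (simp_all add: finite_lists_length_eq)
  have "?f \<in> ?W \<rightarrow> ?B" by (auto simp: count_le_length)
  moreover have "replicate a 0 \<in> ?B" by (auto simp: set_replicate_conv_if)
  ultimately obtain k where k: "k \<in> ?B" "card ?W \<le> card (?f -` {k} \<inter> ?W) * card ?B"
    using pigeonhole_card[of ?f ?W ?B] fin by blast
  define \<kappa> where "\<kappa> c = k ! c" for c
  have "?f w = k \<longleftrightarrow> (\<forall>c<a. count_list w c = \<kappa> c)" for w
    using k(1) by (auto simp: list_eq_iff_nth_eq \<kappa>_def)
  then have sub: "?f -` {k} \<inter> ?W = {w \<in> words a \<kappa>. length w = N}"
    by (auto simp: words_def)
  have len: "length w = (\<Sum>c<a. \<kappa> c)" if "w \<in> words a \<kappa>" for w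
    using that length_word[of w a] by (simp add: words_def)
  have pos: "0 < a ^ N" using assms by simp
  have cards: "card ?W = a ^ N" "card ?B = (N + 1) ^ a"
    using card_lists_length_eq[of "{..<a}" N] card_lists_length_eq[of "{..N}" a] by simp_all
  \<comment> \<open>A word with this content exists, which forces the content to sum to
    \<open>N\<close>.\<close>
  then have "{w \<in> words a \<kappa>. length w = N} \<noteq> {}"
    using k(2) pos unfolding sub by (metis card.empty mult_0 not_le)
  then have N: "(\<Sum>c<a. \<kappa> c) = N" using len by auto
  then have "{w \<in> words a \<kappa>. length w = N} = words a \<kappa>" using len by auto
  then show thesis using that[of \<kappa>] k(2) N unfolding cards sub by simp
qed

lemma count_list_take_mono: "m \<le> m' \<Longrightarrow> count_list (take m l) c \<le> count_list (take m' l) c"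
  by (metis count_list_append le_add1 le_iff_add take_add)

text \<open>In block \<open>s\<close> of the values only the colours \<open>c\<close> with \<open>c \<le> s < c + t\<close> occur, so that
  an entry of colour \<open>c\<close> in block \<open>i\<close> of the positions has its value in block \<open>i + c\<close>: the
  colour, and hence both words, can be read off the merged permutation.\<close>

definition band :: "nat \<Rightarrow> nat list list \<Rightarrow> nat \<Rightarrow> nat list" where
  "band t vs s = concat (map (\<lambda>s. filter (\<lambda>c. c \<le> s \<and> s < c + t) (vs ! s)) [0..<s])"

lemma count_list_filter: "count_list (filter P l) c = (if P c then count_list l c else 0)"
  by (induction l) auto

text \<open>Colour \<open>c\<close> occurs in the blocks from \<open>c\<close> to
  \<open>c + t - 1\<close>, \<open>\<kappa> c\<close> times in each. The truncated difference counts
  those before block \<open>s\<close> and is 0 for \<open>s \<le> c\<close>.\<close>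

lemma count_list_band:
  assumes "c < a" "\<forall>i<s. vs ! i \<in> words a \<kappa>"
  shows "count_list (band t vs s) c = \<kappa> c * (min s (c + t) - c)"
  using assms(2)
proof (induction s)
  case 0
  then show ?case by (simp add: band_def)
next
  case (Suc s)
  have "count_list (vs ! s) c = \<kappa> c" using Suc.prems assms(1) by (auto simp: words_def)
  then have "count_list (band t vs (Suc s)) c =
      count_list (band t vs s) c + (if c \<le> s \<and> s < c + t then \<kappa> c else 0)"
    by (simp add: band_def count_list_filter)
  also have "\<dots> = \<kappa> c * (min (Suc s) (c + t) - c)"
    using Suc by (auto simp: min_def Suc_diff_le)
  finally show ?case .
qed

lemma set_band:
  assumes "\<forall>i<s. vs ! i \<in> words a \<kappa>"
  shows "set (band t vs s) \<subseteq> {..<a}"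
  using assms by (fastforce simp: band_def words_def)

lemma length_band:
  assumes "\<forall>i<s. vs ! i \<in> words a \<kappa>"
  shows "length (band t vs s) = (\<Sum>c<a. \<kappa> c * (min s (c + t) - c))"
  unfolding length_word[OF set_band[OF assms]] using count_list_band[OF _ assms] by simp

lemma take_band:
  assumes "s \<le> s'"
  shows "take (length (band t vs s)) (band t vs s') = band t vs s"
proof -
  have "[0..<s'] = [0..<s] @ [s..<s']" using assms by (metis le_add_diff_inverse upt_add_eq_append zero_le)
  then show ?thesis by (simp add: band_def)
qed

lemma count_list_concat_words:
  assumes "set us \<subseteq> words a \<kappa>" "c < a"
  shows "count_list (concat us) c = length us * \<kappa> c"
  using assms by (induction us) (auto simp: words_def)

text \<open>\<open>off s\<close> is the index where block \<open>s\<close> of the band begins. In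
  block \<open>i = p div N\<close> of \<open>concat us\<close>, the occurrences of colour
  \<open>c\<close> are numbered from \<open>i * \<kappa> c\<close> to
  \<open>Suc i * \<kappa> c - 1\<close>. The band starts colour \<open>c\<close> in block
  \<open>c\<close>, so these numbers fall into its block \<open>i + c\<close>.\<close>

lemma band_block:
  assumes us: "set us \<subseteq> words a \<kappa>" "length us = t" and N: "(\<Sum>c<a. \<kappa> c) = N"
    and vs: "\<forall>i<t + a - 1. vs ! i \<in> words a \<kappa>"
    and p: "p < t * N" and x: "x < length (band t vs (t + a - 1))"
    and col: "band t vs (t + a - 1) ! x = concat us ! p"
    and cnt: "count_list (take p (concat us)) (concat us ! p) =
      count_list (take x (band t vs (t + a - 1))) (concat us ! p)"
  defines "off \<equiv> \<lambda>s. \<Sum>c<a. \<kappa> c * (min s (c + t) - c)"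
  shows "off (p div N + concat us ! p) \<le> x" "x < off (Suc (p div N + concat us ! p))"
    and "concat us ! p < a"
proof -
  let ?u = "concat us" and ?v = "band t vs (t + a - 1)"
  define c where "c = ?u ! p"
  define i where "i = p div N"
  have lenw: "length w = N" if "w \<in> words a \<kappa>" for w
    using that length_word[of w a] N by (simp add: words_def)
  have Npos: "N > 0" using p by (cases N) auto
  have lenu: "length (concat us') = length us' * N" if "set us' \<subseteq> words a \<kappa>" for us'
    using that by (induction us') (auto simp: lenw)
  have pu: "p < length ?u" using lenu[OF us(1)] p us(2) by simp
  have i: "i < t" using p Npos by (simp add: i_def less_mult_imp_div_less)
  have take_u: "take (j * N) ?u = concat (take j us)" if "j \<le> t" for j
  proof -
    have "?u = concat (take j us) @ concat (drop j us)" by (metis append_take_drop_id concat_append)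
    moreover have "length (concat (take j us)) = j * N"
      using lenu[of "take j us"] us that by (auto dest: in_set_takeD)
    ultimately show ?thesis by (metis append_eq_conv_conj)
  qed
  have ca: "c < a"
  proof -
    have "set ?u \<subseteq> {..<a}" using us(1) by (auto simp: words_def)
    then show ?thesis using nth_mem[OF pu] by (auto simp: c_def)
  qed
  have cu: "count_list (take (j * N) ?u) c = j * \<kappa> c" if "j \<le> t" for j
    unfolding take_u[OF that] using us that
    by (subst count_list_concat_words[of _ a \<kappa>]) (auto simp: ca dest: in_set_takeD)
  have cv: "count_list (take (off s) ?v) c = \<kappa> c * (min s (c + t) - c)" if "s \<le> t + a - 1" for s
  proof -
    have vs': "\<forall>i<s. vs ! i \<in> words a \<kappa>" using vs that by auto
    have "take (off s) ?v = band t vs s"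
      using take_band[OF that, of t vs] length_band[OF vs'] by (simp add: off_def)
    then show ?thesis using count_list_band[OF ca vs'] by simp
  qed
  have Suc_take: "count_list (take (Suc q) l) c = Suc (count_list (take q l) c)"
    if "q < length l" "l ! q = c" for q and l :: "nat list"
    using that by (simp add: take_Suc_conv_app_nth)
  let ?n = "count_list (take p ?u) c"
  have n': "?n = count_list (take x ?v) c" using cnt by (simp add: c_def)
  have "i * N \<le> p" by (simp add: i_def)
  then have lo: "i * \<kappa> c \<le> ?n"
    using cu[of i] i count_list_take_mono[of "i * N" p ?u c] by simp
  have "Suc p \<le> Suc i * N" using Npos unfolding i_def by (metis Suc_leI dividend_less_div_times
      add.commute mult_Suc)
  then have "Suc ?n \<le> Suc i * \<kappa> c"
    using cu[of "Suc i"] i count_list_take_mono[of "Suc p" "Suc i * N" ?u c] Suc_take[OF pu] by (simp add: c_def)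
  then have hi: "?n < Suc i * \<kappa> c" by simp
  show "off (p div N + ?u ! p) \<le> x"
  proof (rule ccontr)
    assume "\<not> ?thesis"
    then have "Suc x \<le> off (i + c)" by (simp add: i_def c_def)
    from count_list_take_mono[OF this, of ?v c] have "Suc ?n \<le> \<kappa> c * (min (i + c) (c + t) - c)"
      using cv[of "i + c"] i ca Suc_take[OF x] col n' by (simp add: c_def)
    then show False using lo i by (simp add: mult.commute)
  qed
  show "x < off (Suc (p div N + ?u ! p))"
  proof (rule ccontr)
    assume "\<not> ?thesis"
    then have "off (Suc (i + c)) \<le> x" by (simp add: i_def c_def)
    from count_list_take_mono[OF this, of ?v c] have "\<kappa> c * (min (Suc (i + c)) (c + t) - c) \<le> ?n"
      using cv[of "Suc (i + c)"] i ca n' by simp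
    moreover have "min (Suc (i + c)) (c + t) - c = Suc i" using i by auto
    ultimately show False using hi by (simp add: mult.commute)
  qed
  show "?u ! p < a" using ca by (simp add: c_def)
qed

text \<open>The position word has \<open>t\<close> free blocks. Of the \<open>t + a - 1\<close>
  blocks of the band, those with index from \<open>a - 1\<close> to \<open>t - 1\<close> keep all
  colours and are free; the \<open>t + 1 - a\<close> choices there add up with \<open>t\<close> to
  the exponent. Both words can be decoded from the merged permutation.\<close>

lemma card_merges_ge:
  assumes a: "0 < a" "a \<le> t" and N: "(\<Sum>c<a. \<kappa> c) = N"
  shows "card (words a \<kappa>) ^ (2 * t + 1 - a) \<le> card (merges a (t * N))"
proof (cases "words a \<kappa> = {} \<or> infinite (words a \<kappa>)")
  case True
  \<comment> \<open>The value of \<open>card\<close> is 0 for an infinite set too, and the exponent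
    is positive, so the left side vanishes.\<close>
  then have "card (words a \<kappa>) = 0" by auto
  moreover have "0 < 2 * t + 1 - a" using a by simp
  ultimately show ?thesis by (simp add: zero_power)
next
  case False
  then obtain w0 where w0: "w0 \<in> words a \<kappa>" and finB: "finite (words a \<kappa>)" by blast
  let ?B = "words a \<kappa>"
  define m where "m = t + 1 - a"
  define L where "L k = {us. set us \<subseteq> ?B \<and> length us = k}" for k
  define pad where "pad mid = replicate (a - 1) w0 @ mid @ replicate (a - 1) w0" for mid
  define V where "V mid = band t (pad mid) (t + a - 1)" for mid
  have len_pad: "length (pad mid) = t + a - 1" if "mid \<in> L m" for mid
    using that a by (auto simp: pad_def L_def m_def)
  have "set (pad mid) \<subseteq> ?B" if "mid \<in> L m" for mid
    using that w0 by (auto simp: pad_def L_def)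
  then have pad: "\<forall>i<t + a - 1. pad mid ! i \<in> ?B" if "mid \<in> L m" for mid
    using that len_pad[OF that] by (metis nth_mem subsetD)
  have lenw: "length w = N" if "w \<in> ?B" for w
    using that length_word[of w a] N by (simp add: words_def)
  have lenu: "length (concat us) = t * N" if "us \<in> L t" for us
  proof -
    have "map length us = map (\<lambda>_. N) us" using that lenw by (auto simp: L_def)
    then show ?thesis using that by (simp add: length_concat sum_list_triv L_def del: map_eq_conv)
  qed
  have mset: "mset (concat us) = mset (V mid)" if "us \<in> L t" "mid \<in> L m" for us mid
  proof (rule multiset_eqI)
    fix c
    show "count (mset (concat us)) c = count (mset (V mid)) c"
    proof (cases "c < a")
      case True
      \<comment> \<open>All \<open>t\<close> blocks of a colour \<open>c < a\<close> lie inside the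
        band, so both words contain it \<open>t * \<kappa> c\<close> times.\<close>
      have "min (t + a - 1) (c + t) - c = t" using True by auto
      then show ?thesis
        using count_list_concat_words[of us a \<kappa> c] count_list_band[OF True pad[OF that(2)]] True that
        unfolding count_mset V_def L_def by simp
    next
      case False
      have "c \<notin> set (concat us)" using that False by (auto simp: L_def words_def)
      moreover have "c \<notin> set (V mid)" using set_band[OF pad[OF that(2)]] False by (auto simp: V_def)
      ultimately show ?thesis unfolding count_mset by (simp add: count_list_0_iff[THEN iffD2])
    qed
  qed
  have lenV: "length (V mid) = t * N" if "mid \<in> L m" for mid
  proof -
    have "replicate t w0 \<in> L t" using w0 by (auto simp: L_def)
    from mset[OF this that] lenu[OF this] show ?thesis by (metis size_mset)
  qed
  have "\<exists>\<pi>. \<pi> \<in> merges a (t * N) \<and> map (\<lambda>x. V mid ! (x - 1)) \<pi> = concat us \<and>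
      (\<forall>p<t * N. count_list (take p (concat us)) (concat us ! p) =
        count_list (take (\<pi> ! p - 1) (V mid)) (concat us ! p))"
    if "us \<in> L t" "mid \<in> L m" for us mid
  proof -
    have "set (concat us) \<subseteq> {..<a}" using that by (auto simp: L_def words_def)
    then show ?thesis
      using merge_of_words[OF mset[OF that]] lenu[OF that(1)] lenV[OF that(2)] by metis
  qed
  then obtain merge where merge: "\<And>us mid. us \<in> L t \<Longrightarrow> mid \<in> L m \<Longrightarrow> merge us mid \<in> merges a (t * N)"
    "\<And>us mid. us \<in> L t \<Longrightarrow> mid \<in> L m \<Longrightarrow> map (\<lambda>x. V mid ! (x - 1)) (merge us mid) = concat us"
    "\<And>us mid p. us \<in> L t \<Longrightarrow> mid \<in> L m \<Longrightarrow> p < t * N \<Longrightarrow>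
      count_list (take p (concat us)) (concat us ! p) =
        count_list (take (merge us mid ! p - 1) (V mid)) (concat us ! p)"
    by metis
  define off where "off s = (\<Sum>c<a. \<kappa> c * (min s (c + t) - c))" for s
  have off_mono: "off s \<le> off s'" if "s \<le> s'" for s s'
    unfolding off_def using that by (intro sum_mono mult_le_mono diff_le_mono) auto
  have inj: "us = us' \<and> mid = mid'"
    if L: "us \<in> L t" "mid \<in> L m" "us' \<in> L t" "mid' \<in> L m" and eq: "merge us mid = merge us' mid'"
    for us mid us' mid'
  proof -
    define \<pi> where "\<pi> = merge us mid"
    have set\<pi>: "set \<pi> = {1..t * N}" and len\<pi>: "length \<pi> = t * N"
      using merge(1)[OF L(1,2)] by (auto simp: \<pi>_def merges_def permutations_of_set_def dest: distinct_card)
    have block: "off (p div N + concat us ! p) \<le> \<pi> ! p - 1" "\<pi> ! p - 1 < off (Suc (p div N + concat us ! p))"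
      if "us \<in> L t" "mid \<in> L m" "merge us mid = \<pi>" "p < t * N" for us mid p
    proof -
      have "\<pi> ! p \<in> {1..t * N}" using that(4) set\<pi> len\<pi> nth_mem[of p \<pi>] by simp
      then have "\<pi> ! p - 1 < length (V mid)" using lenV[OF that(2)] by auto
      moreover have "V mid ! (\<pi> ! p - 1) = concat us ! p"
        using arg_cong[OF merge(2)[OF that(1,2)], of "\<lambda>l. l ! p"] that(3,4) len\<pi> by simp
      ultimately show "off (p div N + concat us ! p) \<le> \<pi> ! p - 1"
        "\<pi> ! p - 1 < off (Suc (p div N + concat us ! p))"
        using band_block(1,2)[of us a \<kappa> t N "pad mid" p "\<pi> ! p - 1"] that(1,4) N pad[OF that(2)]
          merge(3)[OF that(1,2,4)] that(3)
        unfolding V_def off_def L_def by auto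
    qed
    \<comment> \<open>Different colours would place the same value in two different blocks of the
      band.\<close>
    have "concat us ! p = concat us' ! p" if p: "p < t * N" for p
    proof -
      note b = block[OF L(1,2) \<pi>_def[symmetric] p]
        and b' = block[OF L(3,4) eq[symmetric, folded \<pi>_def] p]
      show ?thesis
      proof (cases "concat us ! p" "concat us' ! p" rule: linorder_cases)
        case less
        then have "off (Suc (p div N + concat us ! p)) \<le> off (p div N + concat us' ! p)"
          by (intro off_mono) simp
        then show ?thesis using b b' by linarith
      next
        case greater
        then have "off (Suc (p div N + concat us' ! p)) \<le> off (p div N + concat us ! p)"
          by (intro off_mono) simp
        then show ?thesis using b b' by linarith
      qed simp
    qed
    then have cc: "concat us = concat us'"
      using lenu[OF L(1)] lenu[OF L(3)] by (intro nth_equalityI) auto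
    have us: "us = us'"
    proof (rule concat_injective[OF cc])
      have "us ! j \<in> ?B" "us' ! j \<in> ?B" if "j < t" for j
        using subsetD[of "set us" ?B "us ! j"] subsetD[of "set us'" ?B "us' ! j"] L(1,3) that
        by (simp_all add: L_def)
      then show "\<forall>(x, y)\<in>set (zip us us'). length x = length y"
        using L(1,3) by (auto simp: set_zip L_def lenw)
    qed (use L in \<open>simp add: L_def\<close>)
    \<comment> \<open>The colour of a value is the colour of its position, which is already
      known.\<close>
    have "V mid ! y = V mid' ! y" if "y < t * N" for y
    proof -
      have "Suc y \<in> set \<pi>" using that set\<pi> by simp
      moreover have "map (\<lambda>x. V mid ! (x - 1)) \<pi> = map (\<lambda>x. V mid' ! (x - 1)) \<pi>"
        using merge(2)[OF L(1,2)] merge(2)[OF L(3,4)] cc eq by (simp add: \<pi>_def)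
      ultimately show ?thesis unfolding map_eq_conv by fastforce
    qed
    then have "V mid = V mid'"
      using lenV[OF L(2)] lenV[OF L(4)] by (intro nth_equalityI) auto
    \<comment> \<open>Block lengths depend only on \<kappa> and \<open>s\<close>, so the band is cut
      into its blocks in a unique way.\<close>
    moreover have "length (filter (\<lambda>c. c \<le> s \<and> s < c + t) (pad mid ! s)) =
        length (filter (\<lambda>c. c \<le> s \<and> s < c + t) (pad mid' ! s))" if s: "s < t + a - 1" for s
    proof -
      have "length (filter P w) = (\<Sum>c<a. if P c then \<kappa> c else 0)" if "w \<in> ?B" for w P
      proof -
        have "set (filter P w) \<subseteq> {..<a}" using that by (auto simp: words_def)
        from length_word[OF this] show ?thesis
          using that by (auto simp: count_list_filter words_def intro!: sum.cong)
      qed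
      then show ?thesis using pad[OF L(2)] pad[OF L(4)] s by simp
    qed
    ultimately have "map (\<lambda>s. filter (\<lambda>c. c \<le> s \<and> s < c + t) (pad mid ! s)) [0..<t + a - 1] =
        map (\<lambda>s. filter (\<lambda>c. c \<le> s \<and> s < c + t) (pad mid' ! s)) [0..<t + a - 1]"
      unfolding V_def band_def by (intro concat_injective) (auto simp: set_zip)
    then have blk: "filter (\<lambda>c. c \<le> s \<and> s < c + t) (pad mid ! s) =
        filter (\<lambda>c. c \<le> s \<and> s < c + t) (pad mid' ! s)" if "s < t + a - 1" for s
      using that by simp
    have "mid ! j = mid' ! j" if j: "j < m" for j
    proof -
      let ?s = "a - 1 + j"
      have s: "?s < t + a - 1" "?s < t" using j a by (auto simp: m_def)
      \<comment> \<open>For \<open>a - 1 \<le> ?s < t\<close> the band condition keeps every colour,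
        so the block survives unchanged.\<close>
      have filt: "filter (\<lambda>c. c \<le> ?s \<and> ?s < c + t) w = w" if "w \<in> ?B" for w
        using that s by (intro filter_True) (auto simp: words_def)
      have "pad mid ! ?s = mid ! j" "pad mid' ! ?s = mid' ! j"
        using j L by (auto simp: pad_def nth_append L_def)
      moreover have "pad mid ! ?s \<in> ?B" "pad mid' ! ?s \<in> ?B"
        using pad[OF L(2)] pad[OF L(4)] s(1) by blast+
      ultimately show ?thesis
        using blk[OF s(1)] filt[of "pad mid ! ?s"] filt[of "pad mid' ! ?s"] by simp
    qed
    then have "mid = mid'" using L by (intro nth_equalityI) (auto simp: L_def)
    then show ?thesis using us by simp
  qed
  have "card (L t \<times> L m) \<le> card (merges a (t * N))"
    using finite_merges merge(1) inj
    by (intro card_inj_on_le[of "\<lambda>(us, mid). merge us mid"]) (auto simp: inj_on_def)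
  moreover have "card (L k) = card ?B ^ k" for k
    unfolding L_def using finB by (rule card_lists_length_eq)
  moreover have "t + m = 2 * t + 1 - a" using a by (simp add: m_def)
  ultimately show ?thesis by (simp add: card_cartesian_product flip: power_add)
qed

text \<open>For a fixed block length \<open>N\<close>, letting \<open>n\<close> grow gives the lower
  bound \<open>b\<close> to the power \<open>1 / N\<close>, where \<open>b\<close> counts the words
  of a large content. By pigeonhole this is at least \<open>a\<close> divided by a factor that tends
  to 1 as \<open>N\<close> grows.\<close>

lemma liminf_card_merges:
  assumes a: "0 < a" and le: "\<And>n. card (merges a n) \<le> X n"
  shows "ereal (real a) \<le> liminf (\<lambda>n. ereal (real (X n) powr (1 / (2 * real n))))"
    (is "_ \<le> ?L")
proof -
  have N: "ereal (real a / (real N + 1) powr (real a / real N)) \<le> ?L" if "0 < N" for N :: nat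
  proof -
    obtain \<kappa> where big: "a ^ N \<le> card (words a \<kappa>) * (N + 1) ^ a" and sum: "(\<Sum>c<a. \<kappa> c) = N"
      using exists_large_content[OF a] by blast
    define b where "b = card (words a \<kappa>)"
    have "0 < a ^ N" using a by simp
    then have "b \<noteq> 0" using big by (metis b_def mult_0 not_le)
    then have b1: "1 \<le> real b" by simp
    \<comment> \<open>The exponent \<open>2 * t + 1 - a\<close> is at least
      \<open>2 * (n / N - 1) - a\<close>. Rounding in \<open>t = n div N\<close> contributes the 2
      of the error term, and the \<open>a\<close> comes from the exponent itself.\<close>
    have lower: "real b powr (1 / real N - (real a + 2) / (2 * real n)) \<le> real (X n) powr (1 / (2 * real n))"
      if n: "N * a \<le> n" "0 < n" for n
    proof -
      define t where "t = n div N"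
      have t: "a \<le> t" "t * N \<le> n"
        using n \<open>0 < N\<close> by (auto simp: t_def less_eq_div_iff_mult_less_eq mult.commute)
      have "n < (t + 1) * N" using \<open>0 < N\<close> unfolding t_def
        by (metis add.commute dividend_less_div_times mult_Suc plus_1_eq_Suc)
      then have "real n < (real t + 1) * real N"
        by (metis of_nat_1 of_nat_add of_nat_less_iff of_nat_mult)
      then have tn: "real n / real N - 1 \<le> real t" using \<open>0 < N\<close> by (simp add: field_simps)
      have "b ^ (2 * t + 1 - a) \<le> card (merges a (t * N))"
        unfolding b_def by (rule card_merges_ge[OF a t(1) sum])
      also have "\<dots> \<le> card (merges a n)" by (rule card_merges_mono[OF a t(2)])
      also have "\<dots> \<le> X n" by (rule le)
      finally have bX: "real b ^ (2 * t + 1 - a) \<le> real (X n)" by (metis of_nat_le_iff of_nat_power)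
      have "1 / real N - (real a + 2) / (2 * real n) \<le> real (2 * t + 1 - a) * (1 / (2 * real n))"
      proof -
        have "1 / real N - (real a + 2) / (2 * real n) =
            (2 * (real n / real N - 1) - real a) * (1 / (2 * real n))"
          using \<open>0 < n\<close> \<open>0 < N\<close> by (simp add: field_simps)
        also have "\<dots> \<le> real (2 * t + 1 - a) * (1 / (2 * real n))"
          using tn t(1) by (intro mult_right_mono) (auto simp: of_nat_diff)
        finally show ?thesis .
      qed
      then have "real b powr (1 / real N - (real a + 2) / (2 * real n)) \<le>
          real b powr (real (2 * t + 1 - a) * (1 / (2 * real n)))"
        using b1 by (rule powr_mono)
      also have "\<dots> = (real b ^ (2 * t + 1 - a)) powr (1 / (2 * real n))"
        unfolding powr_powr[symmetric] using b1 by (subst powr_realpow) auto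
      also have "\<dots> \<le> real (X n) powr (1 / (2 * real n))"
        using bX by (intro powr_mono2) auto
      finally show ?thesis .
    qed
    have "(\<lambda>n. real b powr (1 / real N - (real a + 2) / (2 * real n))) \<longlonglongrightarrow> real b powr (1 / real N - 0)"
      using b1 by (intro tendsto_powr tendsto_diff tendsto_const) (real_asymp | simp)+
    then have "liminf (\<lambda>n. ereal (real b powr (1 / real N - (real a + 2) / (2 * real n)))) =
        ereal (real b powr (1 / real N))"
      by (intro lim_imp_Liminf) simp_all
    moreover have "liminf (\<lambda>n. ereal (real b powr (1 / real N - (real a + 2) / (2 * real n)))) \<le> ?L"
    proof (rule Liminf_mono)
      show "\<forall>\<^sub>F n in sequentially. ereal (real b powr (1 / real N - (real a + 2) / (2 * real n)))
          \<le> ereal (real (X n) powr (1 / (2 * real n)))"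
        using eventually_ge_at_top[of "Suc (N * a)"] by eventually_elim (simp add: lower)
    qed
    moreover have "real a / (real N + 1) powr (real a / real N) \<le> real b powr (1 / real N)"
    proof -
      have "real a ^ N / (real N + 1) ^ a \<le> real b"
        using of_nat_mono[OF big, where 'a = real] by (simp add: b_def field_simps)
      then have "(real a ^ N / (real N + 1) ^ a) powr (1 / real N) \<le> real b powr (1 / real N)"
        by (intro powr_mono2) auto
      moreover have "(real a ^ N / (real N + 1) ^ a) powr (1 / real N) =
          real a / (real N + 1) powr (real a / real N)"
      proof -
        have root: "(x ^ k) powr (1 / real N) = x powr (real k / real N)" if "0 < x" for x k
          unfolding powr_realpow[OF that, symmetric] powr_powr by simp
        have "(real a ^ N / (real N + 1) ^ a) powr (1 / real N) =
            (real a ^ N) powr (1 / real N) / ((real N + 1) ^ a) powr (1 / real N)"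
          by (rule powr_divide)
        also have "\<dots> = real a powr (real N / real N) / (real N + 1) powr (real a / real N)"
          using a by (subst (1 2) root) auto
        finally show ?thesis using a \<open>0 < N\<close> by simp
      qed
      ultimately show ?thesis by simp
    qed
    ultimately show ?thesis by (simp only: order_trans[OF ereal_less_eq(3)[THEN iffD2]])
  qed
  have "(\<lambda>N::nat. real a / (real N + 1) powr (real a / real N)) \<longlonglongrightarrow> real a"
    by real_asymp
  then have lim: "(\<lambda>N::nat. ereal (real a / (real N + 1) powr (real a / real N))) \<longlonglongrightarrow> ereal (real a)"
    by simp
  show ?thesis
    by (rule LIMSEQ_le_const2[OF lim]) (use N in \<open>auto intro!: exI[of _ 1]\<close>)
qed

theorem corollary4:
  fixes \<mu> :: "nat list"
  assumes "is_partition \<mu>" and "\<mu> \<noteq> []"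
  shows "ereal (real (max (ht \<mu>) (wd \<mu>)))
           \<le> liminf (\<lambda>n. ereal (real (avoid_count \<mu> n) powr (1 / (2 * real n))))
       \<and> limsup (\<lambda>n. ereal (real (avoid_count \<mu> n) powr (1 / (2 * real n))))
           \<le> ereal (real (ht \<mu> + wd \<mu>))"
proof
  let ?a = "max (ht \<mu>) (wd \<mu>)"
  let ?x = "\<lambda>n. ereal (real (avoid_count \<mu> n) powr (1 / (2 * real n)))"
  show "ereal (real ?a) \<le> liminf ?x"
  \<comment> \<open>The bound by merges requires a positive number of classes; for 0 the
    nonnegativity of the terms is enough.\<close>
  proof (cases "?a = 0")
    case True
    then show ?thesis by (auto intro!: Liminf_bounded)
  next
    case False
    have "card (merges ?a n) \<le> avoid_count \<mu> n" for n
      by (rule card_merges_le_avoid_count[OF assms]) (auto simp: max_def)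
    then show ?thesis using False by (intro liminf_card_merges) auto
  qed
  show "limsup ?x \<le> ereal (real (ht \<mu> + wd \<mu>))"
  proof (rule Limsup_bounded)
    show "\<forall>\<^sub>F n in sequentially. ?x n \<le> ereal (real (ht \<mu> + wd \<mu>))"
      \<comment> \<open>At \<open>n = 0\<close> the exponent is \<open>1 / 0 = 0\<close>, and the
        bound fails if \<open>ht \<mu> + wd \<mu> = 0\<close>.\<close>
      using eventually_gt_at_top[of 0]
    proof eventually_elim
      case (elim n)
      let ?K = "ht \<mu> + wd \<mu>"
      have "real (avoid_count \<mu> n) \<le> real ?K ^ (2 * n)"
        using avoid_count_le[OF assms, of n] by (metis of_nat_le_iff of_nat_power)
      then have "real (avoid_count \<mu> n) powr (1 / (2 * real n)) \<le> (real ?K ^ (2 * n)) powr (1 / (2 * real n))"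
        by (intro powr_mono2) auto
      also have "\<dots> = real ?K"
      \<comment> \<open>Rewriting the power as \<open>powr\<close> requires a positive base; for
        \<open>?K = 0\<close> both sides vanish because \<open>n > 0\<close>.\<close>
      proof (cases "?K = 0")
        case False
        then have "real ?K ^ (2 * n) = real ?K powr (2 * real n)"
          by (subst powr_realpow[symmetric]) auto
        then show ?thesis using elim by (simp add: powr_powr)
      qed (use elim in simp)
      finally show ?case by simp
    qed
  qed
qed

end
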